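(* Let $S=\Bbbk[x_1,\dots,x_d]$ be a polynomial ring over a field $\Bbbk$ and let $I\subseteq S$ be a generic monomial ideal. Then $S/I$ has a minimal generalized Barile-Macchia resolution.
   Context: **Generic monomial ideals.** $\mathrm{MinGens}(I)$ is the finite set of minimal monomial generators of $I$. For a monomial $m$, $\mathrm{ord}_i(m)$ is the exponent of the highest power of $x_i$ dividing $m$; $\mathrm{ord}_i(I):=\min\{\mathrm{ord}_i(m): m\in \mathrm{MinGens}(I)\}$. The ideal $I$ is *generic* if whenever there are two different $m,m'\in\mathrm{MinGens}(I)$ with $\mathrm{ord}_i(m)=\mathrm{ord}_i(m')>\mathrm{ord}_i(I)$ for some $1\le i\le d$, there exists a third monomial $m''\in\mathrm{MinGens}(I)$ which divides $\mathrm{lcm}(m,m')$ and such that for every $1\le j\le d$: $\max\{\mathrm{ord}_j(m),\mathrm{ord}_j(m')\}>\mathrm{ord}_j(m'')$ if and only if $\max\{\mathrm{ord}_j(m),\mathrm{ord}_j(m')\}>\mathrm{ord}_j(I)$. **Gradings and matchings.** Let $\mathcal P(\mathrm{MinGens}(I))$ be the power set, ordered by inclusion. For $\sigma\subseteq\mathrm{MinGens}(I)$, $\mathrm{lcm}(\sigma)$ is the least common multiple of its elements ($\mathrm{lcm}(\emptyset)=1$), also regarded as its exponent vector in $\mathbb Z^d$ with the componentwise order. For a poset $P$, an order-preserving map $f:\mathcal P(\mathrm{MinGens}(I))\to P$ is an *lcm-compatible $P$-grading* (of the Taylor resolution of $I$) if there is an order-preserving map $g:P\to\mathbb Z^d$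 with $g\circ f=\mathrm{lcm}$. Let $G_I$ be the directed graph whose vertices are all $\sigma\subseteq\mathrm{MinGens}(I)$ and whose edges are $\sigma\to\tau$ with $\tau\subset\sigma$, $|\tau|=|\sigma|-1$. A set $A$ of edges of $G_I$ is an *$f$-homogeneous acyclic matching* if each vertex lies in at most one edge of $A$, $f(\sigma)=f(\tau)$ for all $\sigma\to\tau$ in $A$, and the graph obtained from $G_I$ by reversing the edges of $A$ has no directed cycle. Subsets in no edge of $A$ are *$A$-critical*. By discrete Morse theory (Batzies–Welker), such an $A$ induces from the Taylor resolution a $\mathbb Z^d$-graded free resolution $\mathcal F_A$ of $S/I$, the *Morse resolution*, in which $(\mathcal F_A)_i$ has a basis identified with the $A$-critical subsets with exactly $i$ elements (the basis element of $\sigma$ having degree $\mathrm{lcm}(\sigma)$). In particular $\mathcal F_A$ is minimal if and only if for every $i$ the number of $A$-critical subsets of cardinality $i$ equals $\dim_\Bbbk\mathrm{Tor}_i^S(S/I,\Bbbk)$. **Bridges and the Barile-Macchia algorithm.** Fix a total order $\succ$ on $\mathrm{MinGens}(I)$. An element $m\in\sigma$ is a *bridge* of $\sigma$ if $\mathrm{lcm}(\sigma\setminus\{m\})=\mathrm{lcm}(\sigma)$. Let $\mathrm{sb}(\sigma)$ be the smallest bridge of $\sigma$ with respect to $\succ$ if $\sigma$ has a bridge, and $\mathrm{sb}(\sigma)=\emptyset$ otherwise (then $\sigma\setminus\{\mathrm{sb}(\sigma)\}$ means $\sigma$). Given a collection $\Omega$ of subsets of $\mathrm{MinGens}(I)$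 of cardinality at least $3$, the algorithm is: start with $A=\emptyset$. (1) Pick $\sigma\in\Omega$ of maximal cardinality. (2) Replace $\Omega$ by $\Omega\setminus\{\sigma,\sigma\setminus\{\mathrm{sb}(\sigma)\}\}$; if $\mathrm{sb}(\sigma)\ne\emptyset$ add the edge $\sigma\to\sigma\setminus\{\mathrm{sb}(\sigma)\}$ to $A$; if $\Omega\neq\emptyset$ return to (1). (3) Whenever $A$ contains distinct edges $\sigma\to\sigma\setminus\{\mathrm{sb}(\sigma)\}$ and $\sigma'\to\sigma'\setminus\{\mathrm{sb}(\sigma')\}$ with $\sigma\setminus\{\mathrm{sb}(\sigma)\}=\sigma'\setminus\{\mathrm{sb}(\sigma')\}$: if $\mathrm{sb}(\sigma')\succ\mathrm{sb}(\sigma)$ remove the edge starting at $\sigma'$ from $A$, otherwise remove the edge starting at $\sigma$. (4) Return $A$. **Generalized Barile-Macchia resolutions.** Let $P$ be a poset, $f$ an lcm-compatible $P$-grading, and $(\succ_p)_{p\in P}$ total orders on $\mathrm{MinGens}(I)$; write $\mathrm{sb}(\sigma):=\mathrm{sb}_{\succ_{f(\sigma)}}(\sigma)$ and assume $f(\sigma\setminus\{\mathrm{sb}(\sigma)\})=f(\sigma)$ for all $\sigma$. For $p\in P$ let $A_p$ be the output of the algorithm applied to $f^{-1}(p)$ (i.e. $\Omega$ is the set of members of $f^{-1}(p)$ of cardinality at least 3) with the order $\succ_p$. Then $A=\bigcup_{p}A_p$ is an $f$-homogeneous acyclic matching and $\mathcal F_A$ is called a *generalized Barile-Macchia resolution*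 of $S/I$. "$S/I$ has a minimal generalized Barile-Macchia resolution" means that for some choice of a poset $P$, an lcm-compatible $P$-grading $f$, and total orders $(\succ_p)_{p\in P}$ on $\mathrm{MinGens}(I)$ satisfying $f(\sigma\setminus\{\mathrm{sb}(\sigma)\})=f(\sigma)$ for all $\sigma\subseteq\mathrm{MinGens}(I)$ (where $\mathrm{sb}(\sigma)=\mathrm{sb}_{\succ_{f(\sigma)}}(\sigma)$), with $A=\bigcup_{p\in P}A_p$ the resulting matching, $\mathcal F_A$ is a minimal free resolution.
   Formalization: The ideal I is assumed proper: for I = S (vacuously generic, MinGens = {1}) the subsets ∅ and {1} have fewer than 3 elements, so both are always critical although all Tor of S/I = 0 vanish, and the claim fails. *)

theory Defs
  imports "HOL-Library.Poly_Mapping" "HOL-Library.FuncSet" Complex_Main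
begin

section \<open>Monomials and monomial ideals\<close>

text \<open>
  The variables are indexed by a finite type \<open>'n\<close>. A monomial is given by its exponent vector
  \<open>m :: 'n \<Rightarrow>\<^sub>0 nat\<close>, so that \<open>ord\<^sub>i(m)\<close> is \<open>lookup m i\<close>. No use is made of the lexicographic
  order that the library puts on \<open>\<Rightarrow>\<^sub>0\<close>.
\<close>

type_synonym 'n mono = "'n \<Rightarrow>\<^sub>0 nat"
type_synonym ('n, 'k) polys = "('n \<Rightarrow>\<^sub>0 nat) \<Rightarrow>\<^sub>0 'k"

abbreviation lookup :: "('a \<Rightarrow>\<^sub>0 'b::zero) \<Rightarrow> 'a \<Rightarrow> 'b" where
  "lookup \<equiv> Poly_Mapping.lookup"

definition monom :: "'n mono \<Rightarrow> ('n, 'k::field) polys" where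
  "monom m = Poly_Mapping.single m 1"

definition mono_dvd :: "'n mono \<Rightarrow> 'n mono \<Rightarrow> bool" where
  "mono_dvd m m' \<longleftrightarrow> (\<forall>i. lookup m i \<le> lookup m' i)"

definition monomial_ideal :: "('n, 'k::field) polys set \<Rightarrow> bool" where
  "monomial_ideal I \<longleftrightarrow> (\<exists>M. I = module.span (*) (monom ` M))"

definition irrelevant_ideal :: "('n, 'k::field) polys set" where
  "irrelevant_ideal = module.span (*) (range (\<lambda>i. monom (Poly_Mapping.single i 1)))"

definition min_gens :: "('n, 'k::field) polys set \<Rightarrow> 'n mono set" where
  "min_gens I = {m. monom m \<in> I \<and> (\<forall>m'. monom m' \<in> I \<and> mono_dvd m' m \<longrightarrow> m' = m)}"

definition ord_ideal :: "'n \<Rightarrow> ('n, 'k::field) polys set \<Rightarrow> nat" where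
  "ord_ideal i I = Min ((\<lambda>m. lookup m i) ` min_gens I)"

definition mono_lcm :: "('n::finite) mono set \<Rightarrow> 'n mono" where
  "mono_lcm \<sigma> = Abs_poly_mapping (\<lambda>i. Max (insert 0 ((\<lambda>m. lookup m i) ` \<sigma>)))"

definition lcm_vec :: "('n::finite) mono set \<Rightarrow> 'n \<Rightarrow> int" where
  "lcm_vec \<sigma> = (\<lambda>i. int (lookup (mono_lcm \<sigma>) i))"

definition generic_ideal :: "('n::finite, 'k::field) polys set \<Rightarrow> bool" where
  "generic_ideal I \<longleftrightarrow>
     (\<forall>m\<in>min_gens I. \<forall>m'\<in>min_gens I. m \<noteq> m' \<longrightarrow>
        (\<exists>i. lookup m i = lookup m' i \<and> lookup m i > ord_ideal i I) \<longrightarrow>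
        (\<exists>m''\<in>min_gens I. m'' \<noteq> m \<and> m'' \<noteq> m' \<and> mono_dvd m'' (mono_lcm {m, m'}) \<and>
           (\<forall>j. max (lookup m j) (lookup m' j) > lookup m'' j \<longleftrightarrow>
                max (lookup m j) (lookup m' j) > ord_ideal j I)))"


section \<open>Gradings and matchings\<close>

text \<open>
  A poset is a carrier \<open>P\<close> with a relation \<open>le\<close>, where \<open>(p, q) \<in> le\<close> means \<open>p \<le> q\<close>.
  \<open>G\<close> stands for the set of minimal generators. The order on \<open>'n \<Rightarrow> int\<close> is the pointwise one.
\<close>

definition lcm_compatible_grading ::
    "('n::finite) mono set \<Rightarrow> 'p set \<Rightarrow> 'p rel \<Rightarrow> ('n mono set \<Rightarrow> 'p) \<Rightarrow> bool" where
  "lcm_compatible_grading G P le f \<longleftrightarrow>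
     f \<in> Pow G \<rightarrow> P \<and>
     (\<forall>\<sigma>\<in>Pow G. \<forall>\<tau>\<in>Pow G. \<tau> \<subseteq> \<sigma> \<longrightarrow> (f \<tau>, f \<sigma>) \<in> le) \<and>
     (\<exists>g :: 'p \<Rightarrow> 'n \<Rightarrow> int.
        (\<forall>p\<in>P. \<forall>q\<in>P. (p, q) \<in> le \<longrightarrow> g p \<le> g q) \<and>
        (\<forall>\<sigma>\<in>Pow G. g (f \<sigma>) = lcm_vec \<sigma>))"

definition taylor_edges :: "'m set \<Rightarrow> ('m set \<times> 'm set) set" where
  "taylor_edges G = {(\<sigma>, \<tau>). \<sigma> \<subseteq> G \<and> \<tau> \<subset> \<sigma> \<and> card \<sigma> = card \<tau> + 1}"

definition reversed_graph ::
    "'m set \<Rightarrow> ('m set \<times> 'm set) set \<Rightarrow> ('m set \<times> 'm set) set" where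
  "reversed_graph G A = (taylor_edges G - A) \<union> A\<inverse>"

definition homogeneous_acyclic_matching ::
    "'m set \<Rightarrow> ('m set \<Rightarrow> 'p) \<Rightarrow> ('m set \<times> 'm set) set \<Rightarrow> bool" where
  "homogeneous_acyclic_matching G f A \<longleftrightarrow>
     A \<subseteq> taylor_edges G \<and>
     (\<forall>(\<sigma>, \<tau>)\<in>A. \<forall>(\<sigma>', \<tau>')\<in>A. (\<sigma>, \<tau>) \<noteq> (\<sigma>', \<tau>') \<longrightarrow> {\<sigma>, \<tau>} \<inter> {\<sigma>', \<tau>'} = {}) \<and>
     (\<forall>(\<sigma>, \<tau>)\<in>A. f \<sigma> = f \<tau>) \<and>
     acyclic (reversed_graph G A)"

definition critical :: "'m set \<Rightarrow> ('m set \<times> 'm set) set \<Rightarrow> 'm set set" where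
  "critical G A = {\<sigma>. \<sigma> \<subseteq> G \<and> (\<forall>(\<sigma>', \<tau>')\<in>A. \<sigma> \<noteq> \<sigma>' \<and> \<sigma> \<noteq> \<tau>')}"


section \<open>Free resolutions\<close>

text \<open>
  A complex of finitely generated free modules \<open>\<dots> \<rightarrow> F\<^sub>2 \<rightarrow> F\<^sub>1 \<rightarrow> F\<^sub>0\<close> over a commutative ring is
  given by a basis \<open>B i\<close> of each \<open>F\<^sub>i\<close> and the matrix entries \<open>D s t\<close>, the coefficient of \<open>t\<close> in the
  image of the basis element \<open>s\<close>. The map \<open>F\<^sub>0 \<rightarrow> S/I\<close> sends a basis element \<open>b\<close> to the class of
  \<open>\<epsilon> b\<close>.
\<close>

definition free_mod :: "'b set \<Rightarrow> ('b \<Rightarrow> 'a::comm_ring_1) set" where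
  "free_mod B = {v. \<forall>b. b \<notin> B \<longrightarrow> v b = 0}"

definition boundary ::
    "(nat \<Rightarrow> 'b set) \<Rightarrow> ('b \<Rightarrow> 'b \<Rightarrow> 'a) \<Rightarrow> nat \<Rightarrow> ('b \<Rightarrow> 'a) \<Rightarrow> 'b \<Rightarrow> 'a::comm_ring_1" where
  \<comment> \<open>the map \<open>F\<^bsub>i+1\<^esub> \<rightarrow> F\<^bsub>i\<^esub>\<close>\<close>
  "boundary B D i v = (\<lambda>t. if t \<in> B i then \<Sum>s\<in>B (Suc i). v s * D s t else 0)"

definition free_resolution_of_quotient ::
    "'a::comm_ring_1 set \<Rightarrow> (nat \<Rightarrow> 'b set) \<Rightarrow> ('b \<Rightarrow> 'b \<Rightarrow> 'a) \<Rightarrow> ('b \<Rightarrow> 'a) \<Rightarrow> bool" where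
  "free_resolution_of_quotient I B D \<epsilon> \<longleftrightarrow>
     (\<forall>i. finite (B i)) \<and>
     (\<forall>s. \<exists>v\<in>free_mod (B 0). (\<Sum>b\<in>B 0. v b * \<epsilon> b) - s \<in> I) \<and>
     {v \<in> free_mod (B 0). (\<Sum>b\<in>B 0. v b * \<epsilon> b) \<in> I} = boundary B D 0 ` free_mod (B 1) \<and>
     (\<forall>i. {v \<in> free_mod (B (Suc i)). boundary B D i v = (\<lambda>_. 0)}
          = boundary B D (Suc i) ` free_mod (B (Suc (Suc i))))"

definition minimal_complex ::
    "(nat \<Rightarrow> 'b set) \<Rightarrow> ('b \<Rightarrow> 'b \<Rightarrow> ('n, 'k::field) polys) \<Rightarrow> bool" where
  "minimal_complex B D \<longleftrightarrow>
     (\<forall>i. \<forall>v\<in>free_mod (B (Suc i)). \<forall>t\<in>B i. boundary B D i v t \<in> irrelevant_ideal)"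


section \<open>The Morse resolution\<close>

text \<open>
  The Taylor resolution needs a reference total order \<open>r\<close> on the generators for its signs; it is
  unrelated to the orders used in the Barile-Macchia algorithm. Here \<open>\<tau> = \<sigma> - {m}\<close>, and the sign
  is \<open>(-1)\<^sup>k\<close> with \<open>k\<close> the number of elements of \<open>\<sigma>\<close> preceding \<open>m\<close>.
\<close>

definition taylor_coeff ::
    "('n::finite) mono rel \<Rightarrow> 'n mono set \<Rightarrow> 'n mono set \<Rightarrow> ('n, 'k::field) polys" where
  "taylor_coeff r \<sigma> \<tau> =
     (-1) ^ card {m' \<in> \<sigma>. \<exists>m\<in>\<sigma> - \<tau>. m' \<noteq> m \<and> (m', m) \<in> r} * monom (mono_lcm \<sigma> - mono_lcm \<tau>)"

text \<open>
  The weight of a reversed matching edge \<open>\<tau> \<rightarrow> \<sigma>\<close> is \<open>-1/[\<sigma>:\<tau>]\<close>. Matched sets have the same lcm,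
  so \<open>[\<sigma>:\<tau>]\<close> is \<open>1\<close> or \<open>-1\<close>, and this equals \<open>-[\<sigma>:\<tau>]\<close>.
\<close>

definition edge_weight ::
    "('n::finite) mono rel \<Rightarrow> 'n mono set \<Rightarrow> 'n mono set \<Rightarrow> ('n, 'k::field) polys" where
  "edge_weight r \<sigma> \<tau> = (if \<tau> \<subset> \<sigma> then taylor_coeff r \<sigma> \<tau> else - taylor_coeff r \<tau> \<sigma>)"

fun path_weight ::
    "('n::finite) mono rel \<Rightarrow> 'n mono set list \<Rightarrow> ('n, 'k::field) polys" where
  "path_weight r (\<sigma> # \<tau> # ps) = edge_weight r \<sigma> \<tau> * path_weight r (\<tau> # ps)"
| "path_weight r _ = 1"

definition graph_paths :: "'v rel \<Rightarrow> 'v \<Rightarrow> 'v \<Rightarrow> 'v list set" where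
  "graph_paths E u v =
     {ps. ps \<noteq> [] \<and> hd ps = u \<and> last ps = v \<and> successively (\<lambda>a b. (a, b) \<in> E) ps}"

definition morse_basis :: "'m set \<Rightarrow> ('m set \<times> 'm set) set \<Rightarrow> nat \<Rightarrow> 'm set set" where
  "morse_basis G A i = {\<sigma> \<in> critical G A. card \<sigma> = i}"

text \<open>
  The differential of the Morse resolution sums the weights of all gradient paths. Between critical
  sets whose cardinalities differ by one, these are exactly the directed paths of the graph with
  \<open>A\<close> reversed; there are finitely many of them if \<open>A\<close> is an acyclic matching of a finite graph.
\<close>

definition morse_diff ::
    "('n::finite) mono rel \<Rightarrow> 'n mono set \<Rightarrow> ('n mono set \<times> 'n mono set) set \<Rightarrow>
     'n mono set \<Rightarrow> 'n mono set \<Rightarrow> ('n, 'k::field) polys" where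
  "morse_diff r G A \<sigma> \<tau> = (\<Sum>ps\<in>graph_paths (reversed_graph G A) \<sigma> \<tau>. path_weight r ps)"

definition minimal_morse_resolution ::
    "('n::finite) mono rel \<Rightarrow> ('n, 'k::field) polys set \<Rightarrow>
     ('n mono set \<times> 'n mono set) set \<Rightarrow> bool" where
  "minimal_morse_resolution r I A \<longleftrightarrow>
     (let B = morse_basis (min_gens I) A;
          D = (morse_diff r (min_gens I) A :: 'n mono set \<Rightarrow> 'n mono set \<Rightarrow> ('n, 'k) polys)
      in free_resolution_of_quotient I B D (\<lambda>_. 1) \<and> minimal_complex B D)"


section \<open>Bridges and the Barile-Macchia algorithm\<close>

text \<open>
  Total orders are reflexive relations, with \<open>(m, m') \<in> r\<close> meaning that \<open>m'\<close> is equal to or larger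
  than \<open>m\<close>.
\<close>

definition bridges :: "('n::finite) mono set \<Rightarrow> 'n mono set" where
  "bridges \<sigma> = {m \<in> \<sigma>. mono_lcm (\<sigma> - {m}) = mono_lcm \<sigma>}"

text \<open>
  \<open>sb r \<sigma>\<close> is the set containing just the smallest bridge, or the empty set if \<open>\<sigma>\<close> has no bridge.
\<close>

definition sb :: "('n::finite) mono rel \<Rightarrow> 'n mono set \<Rightarrow> 'n mono set" where
  "sb r \<sigma> = {m \<in> bridges \<sigma>. \<forall>m'\<in>bridges \<sigma>. (m, m') \<in> r}"

text \<open>
  The first phase picks sets from \<open>\<Omega>\<close> until it is used up: \<open>bm_loop r \<Omega> A A'\<close> means that starting
  with the edge set \<open>A\<close> it can end with \<open>A'\<close>.
\<close>

inductive bm_loop ::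
    "('n::finite) mono rel \<Rightarrow> 'n mono set set \<Rightarrow> ('n mono set \<times> 'n mono set) set \<Rightarrow>
     ('n mono set \<times> 'n mono set) set \<Rightarrow> bool"
  for r where
  loop_done: "bm_loop r {} A A"
| loop_step:
    "\<sigma> \<in> \<Omega> \<Longrightarrow> \<forall>\<tau>\<in>\<Omega>. card \<tau> \<le> card \<sigma> \<Longrightarrow>
     bm_loop r (\<Omega> - {\<sigma>, \<sigma> - sb r \<sigma>})
       (if sb r \<sigma> \<noteq> {} then insert (\<sigma>, \<sigma> - sb r \<sigma>) A else A) A' \<Longrightarrow>
     bm_loop r \<Omega> A A'"

text \<open>
  The second phase: as long as two distinct edges have the same target, the one whose source has the larger
  smallest bridge is removed.
\<close>

inductive bm_prune ::
    "('n::finite) mono rel \<Rightarrow> ('n mono set \<times> 'n mono set) set \<Rightarrow>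
     ('n mono set \<times> 'n mono set) set \<Rightarrow> bool"
  for r where
  prune_done:
    "\<forall>(\<sigma>, \<tau>)\<in>A. \<forall>(\<sigma>', \<tau>')\<in>A. \<tau> = \<tau>' \<longrightarrow> \<sigma> = \<sigma>' \<Longrightarrow> bm_prune r A A"
| prune_step:
    "(\<sigma>, \<tau>) \<in> A \<Longrightarrow> (\<sigma>', \<tau>) \<in> A \<Longrightarrow> \<sigma> \<noteq> \<sigma>' \<Longrightarrow>
     sb r \<sigma> = {m} \<Longrightarrow> sb r \<sigma>' = {m'} \<Longrightarrow>
     bm_prune r (A - {if m' \<noteq> m \<and> (m, m') \<in> r then (\<sigma>', \<tau>) else (\<sigma>, \<tau>)}) A' \<Longrightarrow>
     bm_prune r A A'"

text \<open>
  The algorithm leaves choices open, but its output does not depend on them.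
\<close>

definition bm_output ::
    "('n::finite) mono rel \<Rightarrow> 'n mono set set \<Rightarrow> ('n mono set \<times> 'n mono set) set \<Rightarrow> bool" where
  "bm_output r \<Omega> A \<longleftrightarrow> (\<exists>A'. bm_loop r \<Omega> {} A' \<and> bm_prune r A' A)"


section \<open>Generalized Barile-Macchia resolutions\<close>

definition generalized_bm_matching ::
    "('n::finite) mono set \<Rightarrow> 'p set \<Rightarrow> 'p rel \<Rightarrow> ('n mono set \<Rightarrow> 'p) \<Rightarrow>
     ('p \<Rightarrow> 'n mono rel) \<Rightarrow> ('n mono set \<times> 'n mono set) set \<Rightarrow> bool" where
  "generalized_bm_matching G P le f ord A \<longleftrightarrow>
     partial_order_on P le \<and>
     lcm_compatible_grading G P le f \<and>
     (\<forall>p\<in>P. linear_order_on G (ord p)) \<and>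
     (\<forall>\<sigma>\<in>Pow G. f (\<sigma> - sb (ord (f \<sigma>)) \<sigma>) = f \<sigma>) \<and>
     (\<exists>Ap. (\<forall>p\<in>P. bm_output (ord p) {\<sigma> \<in> Pow G. f \<sigma> = p \<and> card \<sigma> \<ge> 3} (Ap p)) \<and>
           A = (\<Union>p\<in>P. Ap p))"

text \<open>
  Only the elements of \<open>P\<close> in the image of \<open>f\<close> matter, and there are finitely many of these, so it
  is no restriction that the carrier of the poset is a subset of \<open>nat\<close>; the order \<open>le\<close> on it is
  arbitrary. Being a homogeneous acyclic matching is automatic; it is listed because the Morse
  resolution is only defined for such matchings. The order \<open>r\<close> only affects the signs in the Taylor
  resolution.
\<close>

definition has_minimal_generalized_bm_resolution ::
    "('n::finite, 'k::field) polys set \<Rightarrow> bool" where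
  "has_minimal_generalized_bm_resolution I \<longleftrightarrow>
     (\<exists>(P :: nat set) le f ord A.
        generalized_bm_matching (min_gens I) P le f ord A \<and>
        homogeneous_acyclic_matching (min_gens I) f A \<and>
        (\<forall>r. linear_order_on (min_gens I) r \<longrightarrow> minimal_morse_resolution r I A))"

end

theory Submission
  imports Defs
begin

text \<open>
  Let \<open>G\<close> be the set of minimal generators of \<open>I\<close>. The grading is the lcm map itself, with the
  lcm lattice copied into \<open>nat\<close> as its poset, so the sets over a point are all \<open>\<sigma> \<subseteq> G\<close> with a given
  lcm \<open>p\<close>.

  Suppose that two different subsets have lcm \<open>p\<close>. Then their union contains a generator \<open>a\<close> that can
  be dropped without changing the lcm. Either \<open>a\<close> stays strictly below \<open>p\<close> in every coordinate where
  \<open>p\<close> exceeds \<open>ord\<^sub>j(I)\<close>, or another generator shares a maximal exponent with \<open>a\<close> and genericity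
  supplies a third generator that does. Such a strict divisor \<open>m\<close> of \<open>p\<close> is a \<^emph>\<open>pivot\<close>: it never
  contributes to the lcm \<open>p\<close>, so adding it to a set with lcm \<open>p\<close> or removing it keeps the lcm
  (\<open>generic_pivot\<close>). If the pivot is the least element of the order \<open>\<succ>\<^sub>p\<close>, it is the smallest bridge
  of every set containing it, and the algorithm pairs each \<open>\<sigma>\<close> that contains \<open>m\<close> with \<open>\<sigma> - {m}\<close>
  (\<open>bm_output_fibre\<close>). The restriction to sets of cardinality at least three loses nothing: a
  smaller pair would mean that \<open>m\<close> divides \<open>1\<close> or another minimal generator.

  Hence the critical sets are exactly those that share their lcm with no other set, that is, the
  faces of the Scarf complex. Distinct critical sets have distinct lcms, so no entry of the Morse
  differential is a unit (\<open>taylor_morse_minimal\<close>).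

  It remains that the Morse complex is a resolution. This is proved for every lcm-preserving acyclic
  matching that leaves the empty set critical. The Taylor complex is exact because in each
  multidegree it is contracted by coning over a generator (\<open>taylor_resolution\<close>). Sums over gradient
  paths define a surjective chain map from the Taylor complex to the Morse complex; its kernel is
  acyclic, since the part of the differential between matched sets is triangular with units on the
  diagonal (\<open>morse_resolution\<close>).
\<close>

section \<open>Discrete Morse theory over a commutative ring\<close>

lemma taylor_edgesD:
  assumes "(\<sigma>, \<tau>) \<in> taylor_edges G"
  shows "\<sigma> \<subseteq> G" "\<tau> \<subset> \<sigma>" "\<tau> \<subseteq> G" "card \<sigma> = Suc (card \<tau>)"
  using assms by (auto simp: taylor_edges_def)

lemma boundary_mem: "boundary M D i x \<in> free_mod (M i)"
  by (auto simp: boundary_def free_mod_def)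

lemma boundary_boundary_eq_0:
  assumes "\<And>\<upsilon> \<tau>. \<upsilon> \<in> M (Suc (Suc i)) \<Longrightarrow> \<tau> \<in> M i \<Longrightarrow> (\<Sum>\<sigma>\<in>M (Suc i). D \<upsilon> \<sigma> * D \<sigma> \<tau>) = 0"
  shows "boundary M D i (boundary M D (Suc i) x) = (\<lambda>_. 0)"
proof
  fix \<tau>
  show "boundary M D i (boundary M D (Suc i) x) \<tau> = 0"
  proof (cases "\<tau> \<in> M i")
    case True
    have "boundary M D i (boundary M D (Suc i) x) \<tau>
       = (\<Sum>\<sigma>\<in>M (Suc i). \<Sum>\<upsilon>\<in>M (Suc (Suc i)). x \<upsilon> * (D \<upsilon> \<sigma> * D \<sigma> \<tau>))"
      using True by (simp add: boundary_def sum_distrib_right mult.assoc)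
    also have "\<dots> = (\<Sum>\<upsilon>\<in>M (Suc (Suc i)). x \<upsilon> * (\<Sum>\<sigma>\<in>M (Suc i). D \<upsilon> \<sigma> * D \<sigma> \<tau>))"
      by (subst sum.swap) (simp add: sum_distrib_left)
    also have "\<dots> = 0" using assms True by (simp add: sum.neutral)
    finally show ?thesis .
  qed (simp add: boundary_def)
qed

text \<open>
  \<open>d\<close> is the differential of a complex with basis the subsets of \<open>G\<close>, and \<open>Q \<sigma> \<tau>\<close> is the sum of the
  weights of all directed paths from \<open>\<sigma>\<close> to \<open>\<tau>\<close> in the graph with \<open>A\<close> reversed. As that graph is
  acyclic, \<open>Q\<close> is determined by splitting off the first step of a path, and this recursion is what
  the arguments below work with. A reversed edge has weight \<open>- d\<close>; this is minus the inverse of \<open>d\<close>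
  because the square of \<open>d\<close> is \<open>1\<close> on matched pairs.
\<close>

locale morse_matching =
  fixes G :: "'m set" and A :: "('m set \<times> 'm set) set"
    and d :: "'m set \<Rightarrow> 'm set \<Rightarrow> 'a::comm_ring_1"
    and Q :: "'m set \<Rightarrow> 'm set \<Rightarrow> 'a"
  assumes finite_G: "finite G"
    and A_edges: "A \<subseteq> taylor_edges G"
    and A_disjoint: "(\<sigma>, \<tau>) \<in> A \<Longrightarrow> (\<sigma>', \<tau>') \<in> A \<Longrightarrow> (\<sigma>, \<tau>) \<noteq> (\<sigma>', \<tau>') \<Longrightarrow> {\<sigma>, \<tau>} \<inter> {\<sigma>', \<tau>'} = {}"
    and A_acyclic: "acyclic (reversed_graph G A)"
    and d_unit: "(\<sigma>, \<tau>) \<in> A \<Longrightarrow> d \<sigma> \<tau> * d \<sigma> \<tau> = 1"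
    and d_zero: "(\<sigma>, \<tau>) \<notin> taylor_edges G \<Longrightarrow> d \<sigma> \<tau> = 0"
    and d_square: "\<upsilon> \<in> morse_basis G {} (Suc (Suc i)) \<Longrightarrow> \<tau> \<in> morse_basis G {} i \<Longrightarrow>
       (\<Sum>\<sigma>\<in>morse_basis G {} (Suc i). d \<upsilon> \<sigma> * d \<sigma> \<tau>) = 0"
    and Q_rec: "\<sigma> \<subseteq> G \<Longrightarrow> Q \<sigma> \<tau> = (if \<sigma> = \<tau> then 1 else 0) +
       (\<Sum>\<rho> | (\<sigma>, \<rho>) \<in> reversed_graph G A. (if \<rho> \<subset> \<sigma> then d \<sigma> \<rho> else - d \<rho> \<sigma>) * Q \<rho> \<tau>)"
begin

abbreviation "E \<equiv> reversed_graph G A"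
abbreviation "T \<equiv> morse_basis G {}"
abbreviation "B \<equiv> morse_basis G A"

lemma mem_T: "\<sigma> \<in> T i \<longleftrightarrow> \<sigma> \<subseteq> G \<and> card \<sigma> = i"
  by (auto simp: morse_basis_def critical_def)

lemma mem_B: "\<sigma> \<in> B i \<longleftrightarrow> \<sigma> \<in> T i \<and> \<sigma> \<notin> Domain A \<and> \<sigma> \<notin> Range A"
  by (auto simp: morse_basis_def critical_def)

lemma finite_T: "finite (T i)"
  by (rule finite_subset[of _ "Pow G"]) (auto simp: mem_T finite_G)

lemma finite_B: "finite (B i)"
  by (rule finite_subset[OF _ finite_T[of i]]) (auto simp: mem_B)

lemma E_cases:
  assumes "(\<sigma>, \<tau>) \<in> E"
  obtains "(\<sigma>, \<tau>) \<in> taylor_edges G" "(\<sigma>, \<tau>) \<notin> A" | "(\<tau>, \<sigma>) \<in> A"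
  using assms by (auto simp: reversed_graph_def)

lemma E_subset: "E \<subseteq> Pow G \<times> Pow G"
  using A_edges by (auto simp: reversed_graph_def taylor_edges_def)

lemma finite_E: "finite E"
  using finite_subset[OF E_subset] finite_G by auto

lemma wf_E: "wf E"
  using finite_acyclic_wf[OF finite_E A_acyclic] .

lemma wf_E_converse: "wf (E\<inverse>)"
  using finite_acyclic_wf_converse[OF finite_E A_acyclic] .

lemma Domain_Range_disjoint: "\<sigma> \<in> Domain A \<Longrightarrow> \<sigma> \<in> Range A \<Longrightarrow> False"
proof -
  assume "\<sigma> \<in> Domain A" "\<sigma> \<in> Range A"
  then obtain \<tau> \<rho> where "(\<sigma>, \<tau>) \<in> A" "(\<rho>, \<sigma>) \<in> A" by auto
  moreover have "\<rho> \<noteq> \<sigma>" using \<open>(\<rho>, \<sigma>) \<in> A\<close> A_edges by (auto simp: taylor_edges_def)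
  ultimately show False using A_disjoint[of \<sigma> \<tau> \<rho> \<sigma>] by auto
qed

lemma mate_unique: "(\<sigma>, \<tau>) \<in> A \<Longrightarrow> (\<sigma>, \<tau>') \<in> A \<Longrightarrow> \<tau> = \<tau>'"
  using A_disjoint[of \<sigma> \<tau> \<sigma> \<tau>'] by auto

lemma mate_unique': "(\<sigma>, \<tau>) \<in> A \<Longrightarrow> (\<sigma>', \<tau>) \<in> A \<Longrightarrow> \<sigma> = \<sigma>'"
  using A_disjoint[of \<sigma> \<tau> \<sigma>' \<tau>] by auto

text \<open>
  A path can go up only along a reversed matching edge, into an upper end of an edge of \<open>A\<close>. With the
  correction there, the height never increases along a path.
\<close>

definition height :: "'m set \<Rightarrow> nat" where
  "height \<sigma> = (if \<sigma> \<in> Domain A then card \<sigma> - 1 else card \<sigma>)"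

lemma height_le_card: "height \<sigma> \<le> card \<sigma>"
  by (simp add: height_def)

lemma height_mono:
  assumes "(\<sigma>, \<tau>) \<in> E"
  shows "height \<tau> \<le> height \<sigma>"
  using assms
proof (cases rule: E_cases)
  case 1
  then show ?thesis using taylor_edgesD(4)[OF 1(1)] by (auto simp: height_def)
next
  case 2
  then have "\<sigma> \<notin> Domain A" using Domain_Range_disjoint by blast
  moreover have "card \<tau> = Suc (card \<sigma>)" using 2 A_edges taylor_edgesD(4) by blast
  ultimately show ?thesis using 2 by (auto simp: height_def)
qed

lemma Q_eq_0:
  assumes "\<sigma> \<subseteq> G" "height \<sigma> < height \<tau>"
  shows "Q \<sigma> \<tau> = 0"
  using wf_E_converse assms
proof (induction \<sigma>)
  case (less \<sigma>)
  have "Q \<rho> \<tau> = 0" if "(\<sigma>, \<rho>) \<in> E" for \<rho>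
    using less.IH[of \<rho>] that height_mono[OF that] less.prems E_subset by auto
  moreover have "\<sigma> \<noteq> \<tau>" using less.prems by auto
  ultimately show ?case using Q_rec[OF less.prems(1), of \<tau>] by simp
qed

text \<open>
  A path to \<open>\<tau>\<close> cannot step below the level of \<open>\<tau>\<close>: the way back up ends in an upper set, from which
  it must descend at once.
\<close>

lemma Q_below_level_eq_0:
  assumes "(\<sigma>, \<rho>) \<in> taylor_edges G" "card \<sigma> = height \<tau>"
  shows "Q \<rho> \<tau> = 0"
proof (rule Q_eq_0)
  show "\<rho> \<subseteq> G" using taylor_edgesD[OF assms(1)] by simp
  show "height \<rho> < height \<tau>"
    using taylor_edgesD(4)[OF assms(1)] assms(2) height_le_card[of \<rho>] by simp
qed

lemma height_B: "\<tau> \<in> B i \<Longrightarrow> height \<tau> = i"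
  by (auto simp: mem_B mem_T height_def)

lemma E_not_Range:
  assumes "\<sigma> \<notin> Range A"
  shows "(\<sigma>, \<rho>) \<in> E \<longleftrightarrow> (\<sigma>, \<rho>) \<in> taylor_edges G - A"
  using assms by (auto simp: reversed_graph_def)

lemma sum_T_eq_sum_edges:
  assumes "\<sigma> \<in> T (Suc i)"
  shows "(\<Sum>\<rho>\<in>T i. d \<sigma> \<rho> * F \<rho>) = (\<Sum>\<rho> | (\<sigma>, \<rho>) \<in> taylor_edges G. d \<sigma> \<rho> * F \<rho>)"
proof (rule sum.mono_neutral_right[OF finite_T])
  show "{\<rho>. (\<sigma>, \<rho>) \<in> taylor_edges G} \<subseteq> T i"
    using assms by (auto simp: mem_T taylor_edges_def)
qed (auto simp: d_zero)

lemma finite_edges: "finite {\<rho>. (\<sigma>, \<rho>) \<in> taylor_edges G}"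
  by (rule finite_subset[of _ "Pow G"]) (auto simp: taylor_edges_def finite_G)

lemma Q_source:
  assumes "\<sigma> \<subseteq> G" "\<sigma> \<notin> Range A"
  shows "Q \<sigma> \<tau> = (if \<sigma> = \<tau> then 1 else 0) + (\<Sum>\<rho> | (\<sigma>, \<rho>) \<in> taylor_edges G - A. d \<sigma> \<rho> * Q \<rho> \<tau>)"
proof -
  have "(\<Sum>\<rho> | (\<sigma>, \<rho>) \<in> E. (if \<rho> \<subset> \<sigma> then d \<sigma> \<rho> else - d \<rho> \<sigma>) * Q \<rho> \<tau>)
     = (\<Sum>\<rho> | (\<sigma>, \<rho>) \<in> taylor_edges G - A. d \<sigma> \<rho> * Q \<rho> \<tau>)"
    by (rule sum.cong) (auto simp: E_not_Range[OF assms(2)] taylor_edges_def)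
  then show ?thesis using Q_rec[OF assms(1)] by simp
qed

lemma Q_critical_same_level:
  assumes "\<sigma> \<in> B i" "\<tau> \<in> B i"
  shows "Q \<sigma> \<tau> = (if \<sigma> = \<tau> then 1 else 0)"
proof -
  have "\<sigma> \<subseteq> G" "\<sigma> \<notin> Range A" "card \<sigma> = height \<tau>"
    using assms by (auto simp: mem_B mem_T height_B)
  then show ?thesis
    using Q_source[of \<sigma> \<tau>] Q_below_level_eq_0[of \<sigma> _ \<tau>] by simp
qed

lemma Q_upper_eq_0:
  assumes "\<sigma> \<in> Domain A" "\<sigma> \<in> T i" "\<tau> \<in> B i"
  shows "Q \<sigma> \<tau> = 0"
proof (rule Q_eq_0)
  show "\<sigma> \<subseteq> G" using assms by (simp add: mem_T)
  obtain \<rho> where "(\<sigma>, \<rho>) \<in> taylor_edges G" using assms A_edges by auto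
  then have "card \<sigma> \<ge> 1" by (auto simp: taylor_edges_def)
  then show "height \<sigma> < height \<tau>"
    unfolding height_B[OF assms(3)] using assms(1,2) by (simp add: mem_T height_def)
qed

lemma Q_critical_sum:
  assumes "\<sigma> \<in> B (Suc i)" "\<tau> \<in> B i"
  shows "(\<Sum>\<rho>\<in>T i. d \<sigma> \<rho> * Q \<rho> \<tau>) = Q \<sigma> \<tau>"
proof -
  have *: "\<sigma> \<subseteq> G" "\<sigma> \<notin> Range A" "\<sigma> \<noteq> \<tau>" "\<sigma> \<in> T (Suc i)" "\<sigma> \<notin> Domain A"
    using assms by (auto simp: mem_B mem_T)
  have "{\<rho>. (\<sigma>, \<rho>) \<in> taylor_edges G - A} = {\<rho>. (\<sigma>, \<rho>) \<in> taylor_edges G}"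
    using *(5) by auto
  then show ?thesis
    using Q_source[OF *(1,2), of \<tau>] * sum_T_eq_sum_edges[OF *(4), of "\<lambda>\<rho>. Q \<rho> \<tau>"] by simp
qed

text \<open>
  The matching edge is the only useful way out of a lower set on the level of \<open>\<tau>\<close>.
\<close>

lemma Q_lower:
  assumes "(\<upsilon>, \<sigma>) \<in> A" "\<sigma> \<in> T i" "\<tau> \<in> B i"
  shows "Q \<sigma> \<tau> = - d \<upsilon> \<sigma> * Q \<upsilon> \<tau>"
proof -
  have ed: "(\<upsilon>, \<sigma>) \<in> taylor_edges G" using assms A_edges by auto
  have "\<sigma> \<noteq> \<tau>" using assms by (auto simp: mem_B)
  have "(\<upsilon>, \<sigma>) \<notin> taylor_edges G - A" "(\<sigma>, \<upsilon>) \<in> E"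
    using assms by (auto simp: reversed_graph_def)
  have zero: "Q \<rho> \<tau> = 0" if "(\<sigma>, \<rho>) \<in> E" "\<rho> \<noteq> \<upsilon>" for \<rho>
    using that(1)
  proof (cases rule: E_cases)
    case 1
    then show ?thesis using Q_below_level_eq_0[OF 1(1)] assms by (simp add: mem_T height_B)
  next
    case 2
    then show ?thesis using mate_unique' assms that by blast
  qed
  have "(\<Sum>\<rho> | (\<sigma>, \<rho>) \<in> E. (if \<rho> \<subset> \<sigma> then d \<sigma> \<rho> else - d \<rho> \<sigma>) * Q \<rho> \<tau>)
     = (\<Sum>\<rho>\<in>{\<upsilon>}. (if \<rho> \<subset> \<sigma> then d \<sigma> \<rho> else - d \<rho> \<sigma>) * Q \<rho> \<tau>)"
  proof (rule sum.mono_neutral_right)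
    show "finite {\<rho>. (\<sigma>, \<rho>) \<in> E}"
      by (rule finite_subset[of _ "Pow G"]) (use E_subset finite_G in auto)
  qed (use zero \<open>(\<sigma>, \<upsilon>) \<in> E\<close> in auto)
  moreover have "\<not> \<upsilon> \<subset> \<sigma>" using ed by (auto simp: taylor_edges_def)
  ultimately show ?thesis
    using Q_rec[of \<sigma> \<tau>] \<open>\<sigma> \<noteq> \<tau>\<close> assms(2) by (simp add: mem_T)
qed

text \<open>
  A path that starts at an upper set \<open>\<upsilon>\<close> takes any edge except the one to its mate \<open>\<sigma>\<close>. A path that
  starts at \<open>\<sigma>\<close> first climbs to \<open>\<upsilon>\<close>, and the weight of that climb makes the contribution of \<open>\<sigma>\<close> to the
  sum cancel all others.
\<close>

lemma Q_upper_sum: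
  assumes "\<upsilon> \<in> Domain A" "\<upsilon> \<in> T (Suc i)" "\<tau> \<in> B i"
  shows "(\<Sum>\<rho>\<in>T i. d \<upsilon> \<rho> * Q \<rho> \<tau>) = 0"
proof -
  obtain \<sigma> where \<sigma>: "(\<upsilon>, \<sigma>) \<in> A" using assms by auto
  have ed: "(\<upsilon>, \<sigma>) \<in> taylor_edges G" using \<sigma> A_edges by auto
  have \<sigma>T: "\<sigma> \<in> T i" using assms(2) taylor_edgesD[OF ed] by (auto simp: mem_T)
  have set_eq: "{\<rho>. (\<upsilon>, \<rho>) \<in> taylor_edges G} = insert \<sigma> {\<rho>. (\<upsilon>, \<rho>) \<in> taylor_edges G - A}"
    using \<sigma> ed by (auto dest: mate_unique)
  have fin: "finite {\<rho>. (\<upsilon>, \<rho>) \<in> taylor_edges G - A}"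
    by (rule finite_subset[OF _ finite_edges[of \<upsilon>]]) auto
  have "\<upsilon> \<notin> Range A" using assms Domain_Range_disjoint by blast
  moreover have "\<upsilon> \<noteq> \<tau>" "\<upsilon> \<subseteq> G" using assms by (auto simp: mem_B mem_T)
  ultimately have Q\<upsilon>: "Q \<upsilon> \<tau> = (\<Sum>\<rho> | (\<upsilon>, \<rho>) \<in> taylor_edges G - A. d \<upsilon> \<rho> * Q \<rho> \<tau>)"
    using Q_source[of \<upsilon> \<tau>] by simp
  have "(\<Sum>\<rho>\<in>T i. d \<upsilon> \<rho> * Q \<rho> \<tau>) = (\<Sum>\<rho> | (\<upsilon>, \<rho>) \<in> taylor_edges G. d \<upsilon> \<rho> * Q \<rho> \<tau>)"
    by (rule sum_T_eq_sum_edges[OF assms(2)])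
  also have "\<dots> = d \<upsilon> \<sigma> * Q \<sigma> \<tau> + Q \<upsilon> \<tau>"
    unfolding set_eq Q\<upsilon> using fin \<sigma> by (simp add: sum.insert)
  also have "d \<upsilon> \<sigma> * Q \<sigma> \<tau> = - (d \<upsilon> \<sigma> * d \<upsilon> \<sigma>) * Q \<upsilon> \<tau>"
    unfolding Q_lower[OF \<sigma> \<sigma>T assms(3)] by (simp add: algebra_simps)
  finally show ?thesis using d_unit[OF \<sigma>] by simp
qed

text \<open>
  For critical and for upper sets both sides are known. A lower set \<open>\<sigma>\<close> with mate \<open>\<upsilon>\<close> is reduced to
  them: both sides vanish on the boundary of \<open>\<upsilon>\<close>, the left one by \<open>d\<^sup>2 = 0\<close>, and that boundary
  consists of a unit multiple of \<open>\<sigma>\<close> and of sets that come later than \<open>\<sigma>\<close> in the reversed graph.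
\<close>

lemma Q_chain_map:
  assumes "\<sigma> \<in> T (Suc i)" "\<tau> \<in> B i"
  shows "(\<Sum>\<rho>\<in>T i. d \<sigma> \<rho> * Q \<rho> \<tau>) = (\<Sum>\<rho>\<in>B (Suc i). Q \<sigma> \<rho> * Q \<rho> \<tau>)"
  using wf_trancl[OF wf_E_converse] assms(1)
proof (induction \<sigma>)
  case (less \<sigma>)
  define L where "L = (\<lambda>\<sigma>. \<Sum>\<rho>\<in>T i. d \<sigma> \<rho> * Q \<rho> \<tau>)"
  define R where "R = (\<lambda>\<sigma>. \<Sum>\<rho>\<in>B (Suc i). Q \<sigma> \<rho> * Q \<rho> \<tau>)"
  consider "\<sigma> \<in> B (Suc i)" | "\<sigma> \<in> Domain A" | "\<sigma> \<in> Range A"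
    using less.prems mem_B by blast
  then have "L \<sigma> = R \<sigma>"
  proof cases
    case 1
    have "R \<sigma> = (\<Sum>\<rho>\<in>B (Suc i). if \<sigma> = \<rho> then Q \<rho> \<tau> else 0)"
      unfolding R_def by (rule sum.cong) (auto simp: Q_critical_same_level[OF 1])
    also have "\<dots> = Q \<sigma> \<tau>" using 1 by (simp add: finite_B)
    finally show ?thesis using Q_critical_sum[OF 1 assms(2)] by (simp add: L_def)
  next
    case 2
    then show ?thesis
      using Q_upper_sum[OF 2 less.prems assms(2)] Q_upper_eq_0[OF 2 less.prems]
      by (simp add: L_def R_def)
  next
    case 3
    then obtain \<upsilon> where \<upsilon>: "(\<upsilon>, \<sigma>) \<in> A" by auto
    have ed: "(\<upsilon>, \<sigma>) \<in> taylor_edges G" using \<upsilon> A_edges by auto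
    have \<upsilon>T: "\<upsilon> \<in> T (Suc (Suc i))" using taylor_edgesD[OF ed] less.prems by (simp add: mem_T)
    have "(\<Sum>\<rho>\<in>T (Suc i). d \<upsilon> \<rho> * L \<rho>) = (\<Sum>\<pi>\<in>T i. (\<Sum>\<rho>\<in>T (Suc i). d \<upsilon> \<rho> * d \<rho> \<pi>) * Q \<pi> \<tau>)"
      unfolding L_def sum_distrib_left sum_distrib_right
      by (subst sum.swap) (simp add: mult.assoc)
    also have "\<dots> = 0" using d_square[OF \<upsilon>T] by simp
    finally have L0: "(\<Sum>\<rho>\<in>T (Suc i). d \<upsilon> \<rho> * L \<rho>) = 0" .
    have "(\<Sum>\<rho>\<in>T (Suc i). d \<upsilon> \<rho> * R \<rho>)
        = (\<Sum>\<pi>\<in>B (Suc i). (\<Sum>\<rho>\<in>T (Suc i). d \<upsilon> \<rho> * Q \<rho> \<pi>) * Q \<pi> \<tau>)"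
      unfolding R_def sum_distrib_left sum_distrib_right
      by (subst sum.swap) (simp add: mult.assoc)
    also have "\<dots> = 0"
    proof (rule sum.neutral, rule ballI)
      fix \<pi> assume "\<pi> \<in> B (Suc i)"
      then have "(\<Sum>\<rho>\<in>T (Suc i). d \<upsilon> \<rho> * Q \<rho> \<pi>) = 0"
        using Q_upper_sum[OF _ \<upsilon>T] \<upsilon> by blast
      then show "(\<Sum>\<rho>\<in>T (Suc i). d \<upsilon> \<rho> * Q \<rho> \<pi>) * Q \<pi> \<tau> = 0" by simp
    qed
    finally have "(\<Sum>\<rho>\<in>T (Suc i). d \<upsilon> \<rho> * (L \<rho> - R \<rho>)) = 0"
      using L0 by (simp add: algebra_simps sum_subtractf)
    also have "(\<Sum>\<rho>\<in>T (Suc i). d \<upsilon> \<rho> * (L \<rho> - R \<rho>)) = (\<Sum>\<rho>\<in>{\<sigma>}. d \<upsilon> \<rho> * (L \<rho> - R \<rho>))"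
    proof (rule sum.mono_neutral_right[OF finite_T])
      show "\<forall>\<rho>\<in>T (Suc i) - {\<sigma>}. d \<upsilon> \<rho> * (L \<rho> - R \<rho>) = 0"
      proof
        fix \<rho> assume \<rho>: "\<rho> \<in> T (Suc i) - {\<sigma>}"
        show "d \<upsilon> \<rho> * (L \<rho> - R \<rho>) = 0"
        proof (cases "(\<upsilon>, \<rho>) \<in> taylor_edges G")
          case True
          then have "(\<upsilon>, \<rho>) \<in> E" "(\<sigma>, \<upsilon>) \<in> E"
            using \<rho> \<upsilon> mate_unique[OF \<upsilon>, of \<rho>] by (auto simp: reversed_graph_def)
          then have "(\<rho>, \<upsilon>) \<in> E\<inverse>" "(\<upsilon>, \<sigma>) \<in> E\<inverse>" by auto
          then have "(\<rho>, \<sigma>) \<in> (E\<inverse>)\<^sup>+" by (meson r_into_trancl trancl_into_trancl)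
          then show ?thesis using less.IH \<rho> by (simp add: L_def R_def)
        qed (simp add: d_zero)
      qed
    qed (use less.prems in auto)
    finally have "d \<upsilon> \<sigma> * (L \<sigma> - R \<sigma>) = 0" by simp
    then have "d \<upsilon> \<sigma> * d \<upsilon> \<sigma> * (L \<sigma> - R \<sigma>) = 0" by (simp add: mult.assoc)
    then show ?thesis using d_unit[OF \<upsilon>] by simp
  qed
  then show ?case by (simp add: L_def R_def)
qed

text \<open>
  The linear extension of \<open>Q\<close> to a map from the full complex to the Morse complex.
\<close>

definition proj :: "nat \<Rightarrow> ('m set \<Rightarrow> 'a) \<Rightarrow> 'm set \<Rightarrow> 'a" where
  "proj i x = (\<lambda>\<tau>. if \<tau> \<in> B i then \<Sum>\<sigma>\<in>T i. x \<sigma> * Q \<sigma> \<tau> else 0)"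

lemma proj_boundary: "proj i (boundary T d i x) = boundary B Q i (proj (Suc i) x)"
proof
  fix \<tau>
  show "proj i (boundary T d i x) \<tau> = boundary B Q i (proj (Suc i) x) \<tau>"
  proof (cases "\<tau> \<in> B i")
    case True
    have "proj i (boundary T d i x) \<tau> = (\<Sum>\<rho>\<in>T i. \<Sum>\<sigma>\<in>T (Suc i). x \<sigma> * d \<sigma> \<rho> * Q \<rho> \<tau>)"
      using True by (simp add: proj_def boundary_def sum_distrib_right)
    also have "\<dots> = (\<Sum>\<sigma>\<in>T (Suc i). x \<sigma> * (\<Sum>\<rho>\<in>T i. d \<sigma> \<rho> * Q \<rho> \<tau>))"
      by (subst sum.swap) (simp add: sum_distrib_left mult.assoc)
    also have "\<dots> = (\<Sum>\<sigma>\<in>T (Suc i). x \<sigma> * (\<Sum>\<rho>\<in>B (Suc i). Q \<sigma> \<rho> * Q \<rho> \<tau>))"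
      by (rule sum.cong) (auto simp: Q_chain_map[OF _ True])
    also have "\<dots> = (\<Sum>\<rho>\<in>B (Suc i). \<Sum>\<sigma>\<in>T (Suc i). x \<sigma> * Q \<sigma> \<rho> * Q \<rho> \<tau>)"
      by (subst sum.swap) (simp add: sum_distrib_left mult.assoc)
    also have "\<dots> = boundary B Q i (proj (Suc i) x) \<tau>"
      using True by (simp add: proj_def boundary_def sum_distrib_right)
    finally show ?thesis .
  qed (simp add: proj_def boundary_def)
qed

lemma proj_critical:
  assumes "x \<in> free_mod (B i)"
  shows "proj i x = x"
proof
  fix \<tau>
  show "proj i x \<tau> = x \<tau>"
  proof (cases "\<tau> \<in> B i")
    case True
    have "(\<Sum>\<sigma>\<in>T i. x \<sigma> * Q \<sigma> \<tau>) = (\<Sum>\<sigma>\<in>B i. x \<sigma> * Q \<sigma> \<tau>)"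
      using assms by (intro sum.mono_neutral_right finite_T) (auto simp: mem_B free_mod_def)
    also have "\<dots> = (\<Sum>\<sigma>\<in>B i. if \<sigma> = \<tau> then x \<sigma> else 0)"
      by (rule sum.cong) (auto simp: Q_critical_same_level[OF _ True])
    also have "\<dots> = x \<tau>" using True by (simp add: finite_B)
    finally show ?thesis using True by (simp add: proj_def)
  qed (use assms in \<open>auto simp: proj_def free_mod_def\<close>)
qed

lemma proj_upper:
  assumes "\<And>\<sigma>. \<sigma> \<notin> Domain A \<Longrightarrow> x \<sigma> = 0"
  shows "proj i x = (\<lambda>_. 0)"
proof -
  have "x \<sigma> * Q \<sigma> \<tau> = 0" if "\<sigma> \<in> T i" "\<tau> \<in> B i" for \<sigma> \<tau>
    using assms[of \<sigma>] Q_upper_eq_0[of \<sigma> i \<tau>] that by (cases "\<sigma> \<in> Domain A") auto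
  then show ?thesis by (auto simp: proj_def fun_eq_iff)
qed

lemma proj_diff: "proj i (\<lambda>\<sigma>. x \<sigma> - y \<sigma>) = (\<lambda>\<tau>. proj i x \<tau> - proj i y \<tau>)"
  by (auto simp: proj_def fun_eq_iff algebra_simps sum_subtractf)

lemma proj_mem: "proj i x \<in> free_mod (B i)"
  by (auto simp: proj_def free_mod_def)

lemma free_mod_B_T: "x \<in> free_mod (B i) \<Longrightarrow> x \<in> free_mod (T i)"
  by (auto simp: free_mod_def mem_B)

lemma boundary_diff:
  "boundary T d i (\<lambda>\<sigma>. x \<sigma> - y \<sigma>) = (\<lambda>\<tau>. boundary T d i x \<tau> - boundary T d i y \<tau>)"
  by (auto simp: boundary_def fun_eq_iff algebra_simps sum_subtractf)

lemma boundary_boundary: "boundary T d i (boundary T d (Suc i) x) = (\<lambda>_. 0)"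
  by (rule boundary_boundary_eq_0) (rule d_square)

text \<open>
  Together with \<open>upper_boundary_surj\<close> this says that the block of \<open>d\<close> from upper to lower sets is
  invertible. In the order given by the reversed graph the block is triangular, with the units
  \<open>d \<upsilon> \<tau>\<close> of the matched pairs on its diagonal.
\<close>

lemma upper_boundary_inj:
  assumes x: "\<And>\<sigma>. \<sigma> \<notin> Domain A \<Longrightarrow> x \<sigma> = 0"
    and bd: "\<And>\<tau>. \<tau> \<in> Range A \<Longrightarrow> boundary T d i x \<tau> = 0"
    and "\<upsilon> \<in> T (Suc i)"
  shows "x \<upsilon> = 0"
  using wf_trancl[OF wf_E] \<open>\<upsilon> \<in> T (Suc i)\<close>
proof (induction \<upsilon>)
  case (less \<upsilon>)
  show ?case
  proof (cases "\<upsilon> \<in> Domain A")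
    case True
    then obtain \<tau> where \<tau>: "(\<upsilon>, \<tau>) \<in> A" by auto
    then have ed: "(\<upsilon>, \<tau>) \<in> taylor_edges G" using A_edges by auto
    have \<tau>T: "\<tau> \<in> T i" using taylor_edgesD[OF ed] less.prems by (simp add: mem_T)
    have "0 = (\<Sum>\<sigma>\<in>T (Suc i). x \<sigma> * d \<sigma> \<tau>)"
      using bd[of \<tau>] \<tau> \<tau>T by (auto simp: boundary_def)
    also have "\<dots> = (\<Sum>\<sigma>\<in>{\<upsilon>}. x \<sigma> * d \<sigma> \<tau>)"
    proof (rule sum.mono_neutral_right[OF finite_T])
      show "\<forall>\<sigma>\<in>T (Suc i) - {\<upsilon>}. x \<sigma> * d \<sigma> \<tau> = 0"
      proof
        fix \<sigma> assume \<sigma>: "\<sigma> \<in> T (Suc i) - {\<upsilon>}"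
        show "x \<sigma> * d \<sigma> \<tau> = 0"
        proof (cases "(\<sigma>, \<tau>) \<in> taylor_edges G")
          case True
          moreover have "(\<sigma>, \<tau>) \<notin> A" using \<sigma> \<tau> mate_unique' by blast
          ultimately have "(\<sigma>, \<tau>) \<in> E" "(\<tau>, \<upsilon>) \<in> E" using \<tau> by (auto simp: reversed_graph_def)
          then have "(\<sigma>, \<upsilon>) \<in> E\<^sup>+" by auto
          then show ?thesis using less.IH \<sigma> by simp
        qed (simp add: d_zero)
      qed
    qed (use less.prems in auto)
    finally have "x \<upsilon> * d \<upsilon> \<tau> * d \<upsilon> \<tau> = 0" by simp
    then show ?thesis using d_unit[OF \<tau>] by (simp add: mult.assoc)
  qed (use x in simp)
qed

text \<open>
  Up to the unit \<open>d \<upsilon> \<sigma>\<close>, the mate \<open>\<upsilon>\<close> of \<open>\<sigma>\<close> has the right boundary except for lower sets that come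
  later in the reversed graph; these are corrected by induction.
\<close>

lemma upper_boundary_basis:
  assumes "\<sigma> \<in> T i" "\<sigma> \<in> Range A"
  shows "\<exists>k\<in>free_mod (T (Suc i)). (\<forall>\<upsilon>. \<upsilon> \<notin> Domain A \<longrightarrow> k \<upsilon> = 0) \<and>
           (\<forall>\<tau>\<in>Range A \<inter> T i. boundary T d i k \<tau> = (if \<tau> = \<sigma> then 1 else 0))"
  using wf_trancl[OF wf_E_converse] assms
proof (induction \<sigma>)
  case (less \<sigma>)
  obtain \<upsilon> where \<upsilon>: "(\<upsilon>, \<sigma>) \<in> A" using less.prems by auto
  then have ed: "(\<upsilon>, \<sigma>) \<in> taylor_edges G" using A_edges by auto
  have \<upsilon>T: "\<upsilon> \<in> T (Suc i)" using taylor_edgesD[OF ed] less.prems by (simp add: mem_T)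
  define W where "W = {\<tau> \<in> Range A \<inter> T i. (\<upsilon>, \<tau>) \<in> taylor_edges G \<and> \<tau> \<noteq> \<sigma>}"
  have finW: "finite W" by (rule finite_subset[OF _ finite_T[of i]]) (auto simp: W_def)
  have "\<exists>k\<in>free_mod (T (Suc i)). (\<forall>\<upsilon>. \<upsilon> \<notin> Domain A \<longrightarrow> k \<upsilon> = 0) \<and>
           (\<forall>\<tau>\<in>Range A \<inter> T i. boundary T d i k \<tau> = (if \<tau> = \<rho> then 1 else 0))"
    if "\<rho> \<in> W" for \<rho>
  proof (rule less.IH)
    have "(\<upsilon>, \<rho>) \<notin> A" using \<upsilon> that mate_unique by (auto simp: W_def)
    then have "(\<rho>, \<upsilon>) \<in> E\<inverse>" "(\<upsilon>, \<sigma>) \<in> E\<inverse>"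
      using that \<upsilon> by (auto simp: W_def reversed_graph_def)
    then show "(\<rho>, \<sigma>) \<in> (E\<inverse>)\<^sup>+" by (meson r_into_trancl trancl_into_trancl)
  qed (use that in \<open>auto simp: W_def\<close>)
  then obtain K where K: "\<And>\<rho>. \<rho> \<in> W \<Longrightarrow> K \<rho> \<in> free_mod (T (Suc i))"
    "\<And>\<rho> \<upsilon>. \<rho> \<in> W \<Longrightarrow> \<upsilon> \<notin> Domain A \<Longrightarrow> K \<rho> \<upsilon> = 0"
    "\<And>\<rho> \<tau>. \<rho> \<in> W \<Longrightarrow> \<tau> \<in> Range A \<inter> T i \<Longrightarrow> boundary T d i (K \<rho>) \<tau> = (if \<tau> = \<rho> then 1 else 0)"
    by metis
  \<comment> \<open>\<open>W\<close> collects the unwanted lower sets in the boundary of \<open>\<upsilon>\<close>\<close>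
  define k where "k = (\<lambda>\<pi>. d \<upsilon> \<sigma> * ((if \<pi> = \<upsilon> then 1 else 0) - (\<Sum>\<rho>\<in>W. d \<upsilon> \<rho> * K \<rho> \<pi>)))"
  have "k \<in> free_mod (T (Suc i))"
    using K(1) \<upsilon>T by (auto simp: k_def free_mod_def intro!: sum.neutral)
  moreover have "k \<pi> = 0" if "\<pi> \<notin> Domain A" for \<pi>
    using K(2) \<upsilon> that by (auto simp: k_def intro!: sum.neutral)
  moreover have "boundary T d i k \<tau> = (if \<tau> = \<sigma> then 1 else 0)" if \<tau>: "\<tau> \<in> Range A \<inter> T i" for \<tau>
  proof -
    have \<tau>T: "\<tau> \<in> T i" using \<tau> by simp
    have "boundary T d i k \<tau>
       = d \<upsilon> \<sigma> * ((\<Sum>\<pi>\<in>T (Suc i). (if \<pi> = \<upsilon> then 1 else 0) * d \<pi> \<tau>)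
           - (\<Sum>\<pi>\<in>T (Suc i). (\<Sum>\<rho>\<in>W. d \<upsilon> \<rho> * K \<rho> \<pi>) * d \<pi> \<tau>))"
      using \<tau>T by (simp add: boundary_def k_def sum_distrib_left sum_subtractf algebra_simps)
    also have "(\<Sum>\<pi>\<in>T (Suc i). (if \<pi> = \<upsilon> then 1 else 0) * d \<pi> \<tau>) = d \<upsilon> \<tau>"
      using \<upsilon>T by (simp add: finite_T if_distrib[of "\<lambda>x. x * _"] cong: if_cong)
    also have "(\<Sum>\<pi>\<in>T (Suc i). (\<Sum>\<rho>\<in>W. d \<upsilon> \<rho> * K \<rho> \<pi>) * d \<pi> \<tau>)
        = (\<Sum>\<rho>\<in>W. d \<upsilon> \<rho> * boundary T d i (K \<rho>) \<tau>)"
      using \<tau>T unfolding boundary_def sum_distrib_right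
      by (subst sum.swap) (simp add: sum_distrib_left mult.assoc)
    also have "\<dots> = (\<Sum>\<rho>\<in>W. if \<tau> = \<rho> then d \<upsilon> \<rho> else 0)"
      by (rule sum.cong) (use K(3) \<tau> in auto)
    also have "\<dots> = (if \<tau> \<in> W then d \<upsilon> \<tau> else 0)" using finW by simp
    finally have "boundary T d i k \<tau> = d \<upsilon> \<sigma> * (d \<upsilon> \<tau> - (if \<tau> \<in> W then d \<upsilon> \<tau> else 0))" .
    moreover have "\<tau> \<in> W \<or> \<tau> = \<sigma> \<or> d \<upsilon> \<tau> = 0"
      using \<tau> d_zero[of \<upsilon> \<tau>] by (auto simp: W_def)
    moreover have "\<sigma> \<notin> W" by (simp add: W_def)
    ultimately show ?thesis using d_unit[OF \<upsilon>] by auto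
  qed
  ultimately show ?case by blast
qed

lemma upper_boundary_surj:
  "\<exists>k\<in>free_mod (T (Suc i)). (\<forall>\<upsilon>. \<upsilon> \<notin> Domain A \<longrightarrow> k \<upsilon> = 0) \<and>
     (\<forall>\<tau>\<in>Range A \<inter> T i. boundary T d i k \<tau> = z \<tau>)"
proof -
  obtain K where K: "\<And>\<rho>. \<rho> \<in> Range A \<inter> T i \<Longrightarrow> K \<rho> \<in> free_mod (T (Suc i))"
    "\<And>\<rho> \<upsilon>. \<rho> \<in> Range A \<inter> T i \<Longrightarrow> \<upsilon> \<notin> Domain A \<Longrightarrow> K \<rho> \<upsilon> = 0"
    "\<And>\<rho> \<tau>. \<rho> \<in> Range A \<inter> T i \<Longrightarrow> \<tau> \<in> Range A \<inter> T i \<Longrightarrow>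
       boundary T d i (K \<rho>) \<tau> = (if \<tau> = \<rho> then 1 else 0)"
  proof -
    have "\<forall>\<rho>\<in>Range A \<inter> T i. \<exists>k. k \<in> free_mod (T (Suc i)) \<and> (\<forall>\<upsilon>. \<upsilon> \<notin> Domain A \<longrightarrow> k \<upsilon> = 0) \<and>
           (\<forall>\<tau>\<in>Range A \<inter> T i. boundary T d i k \<tau> = (if \<tau> = \<rho> then 1 else 0))"
      using upper_boundary_basis[of _ i] by blast
    from bchoice[OF this] show ?thesis using that by blast
  qed
  define k where "k = (\<lambda>\<pi>. \<Sum>\<rho>\<in>Range A \<inter> T i. z \<rho> * K \<rho> \<pi>)"
  have "k \<in> free_mod (T (Suc i))"
    using K(1) by (auto simp: k_def free_mod_def intro!: sum.neutral)
  moreover have "\<forall>\<upsilon>. \<upsilon> \<notin> Domain A \<longrightarrow> k \<upsilon> = 0"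
    using K(2) by (auto simp: k_def intro!: sum.neutral)
  moreover have "boundary T d i k \<tau> = z \<tau>" if \<tau>: "\<tau> \<in> Range A \<inter> T i" for \<tau>
  proof -
    have "boundary T d i k \<tau> = (\<Sum>\<rho>\<in>Range A \<inter> T i. z \<rho> * boundary T d i (K \<rho>) \<tau>)"
      using \<tau> unfolding boundary_def k_def sum_distrib_right
      by (simp, subst sum.swap) (simp add: sum_distrib_left mult.assoc)
    also have "\<dots> = (\<Sum>\<rho>\<in>Range A \<inter> T i. if \<tau> = \<rho> then z \<rho> else 0)"
      by (rule sum.cong) (use K(3) \<tau> in auto)
    also have "\<dots> = z \<tau>" using \<tau> finite_T by simp
    finally show ?thesis .
  qed
  ultimately show ?thesis by blast
qed

text \<open>
  Some chain \<open>k\<close> of upper sets has the same lower part of its boundary as \<open>z\<close>. Then \<open>z - \<partial>k\<close> has no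
  lower part, and no critical part because \<open>proj\<close> kills it, so it consists of upper sets. It is also
  a cycle, hence zero by injectivity of the block from upper to lower sets.
\<close>

lemma proj_kernel_acyclic:
  assumes z: "z \<in> free_mod (T i)" and pz: "proj i z = (\<lambda>_. 0)"
    and cyc: "\<And>j. i = Suc j \<Longrightarrow> boundary T d j z = (\<lambda>_. 0)"
  shows "\<exists>k\<in>free_mod (T (Suc i)). (\<forall>\<upsilon>. \<upsilon> \<notin> Domain A \<longrightarrow> k \<upsilon> = 0) \<and> boundary T d i k = z"
proof -
  obtain k where k: "k \<in> free_mod (T (Suc i))" "\<And>\<upsilon>. \<upsilon> \<notin> Domain A \<Longrightarrow> k \<upsilon> = 0"
    "\<And>\<tau>. \<tau> \<in> Range A \<Longrightarrow> \<tau> \<in> T i \<Longrightarrow> boundary T d i k \<tau> = z \<tau>"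
    using upper_boundary_surj[of i z] by blast
  define y where "y = (\<lambda>\<sigma>. z \<sigma> - boundary T d i k \<sigma>)"
  have yT: "y \<in> free_mod (T i)"
    using z boundary_mem[of T d i k] by (auto simp: y_def free_mod_def)
  have y_lower: "y \<sigma> = 0" if "\<sigma> \<in> Range A" for \<sigma>
    using k(3)[OF that] yT by (cases "\<sigma> \<in> T i") (auto simp: y_def free_mod_def)
  have "proj i y = (\<lambda>_. 0)"
  proof -
    have "proj (Suc i) k = (\<lambda>_. 0)" by (rule proj_upper) (rule k(2))
    then have "proj i (boundary T d i k) = (\<lambda>_. 0)"
      by (simp add: proj_boundary) (auto simp: boundary_def)
    then show ?thesis unfolding y_def proj_diff pz by simp
  qed
  have y_crit: "y \<tau> = 0" if \<tau>: "\<tau> \<in> B i" for \<tau>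
  proof -
    have "0 = (\<Sum>\<sigma>\<in>T i. y \<sigma> * Q \<sigma> \<tau>)"
      using fun_cong[OF \<open>proj i y = (\<lambda>_. 0)\<close>, of \<tau>] \<tau> by (simp add: proj_def)
    also have "\<dots> = (\<Sum>\<sigma>\<in>T i. if \<sigma> = \<tau> then y \<sigma> else 0)"
    proof (rule sum.cong[OF refl])
      fix \<sigma> assume "\<sigma> \<in> T i"
      then consider "\<sigma> \<in> B i" | "\<sigma> \<in> Domain A" | "\<sigma> \<in> Range A" using mem_B by blast
      then show "y \<sigma> * Q \<sigma> \<tau> = (if \<sigma> = \<tau> then y \<sigma> else 0)"
      proof cases
        case 1
        then show ?thesis using Q_critical_same_level[OF 1 \<tau>] by simp
      next
        case 2
        moreover have "\<sigma> \<noteq> \<tau>" using 2 \<tau> by (auto simp: mem_B)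
        ultimately show ?thesis using Q_upper_eq_0[OF 2 \<open>\<sigma> \<in> T i\<close> \<tau>] by simp
      next
        case 3
        then show ?thesis using y_lower[OF 3] by auto
      qed
    qed
    also have "\<dots> = y \<tau>" using \<tau> by (simp add: finite_T mem_B)
    finally show ?thesis by simp
  qed
  have y_notU: "y \<sigma> = 0" if "\<sigma> \<notin> Domain A" for \<sigma>
  proof (cases "\<sigma> \<in> T i")
    case True
    then have "\<sigma> \<in> B i \<or> \<sigma> \<in> Range A" using that mem_B[of \<sigma> i] by blast
    then show ?thesis using y_crit[of \<sigma>] y_lower[of \<sigma>] by blast
  qed (use yT in \<open>simp add: free_mod_def\<close>)
  have "y = (\<lambda>_. 0)"
  proof
    fix \<sigma>
    show "y \<sigma> = 0"
    proof (cases "\<sigma> \<in> T i \<and> \<sigma> \<in> Domain A")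
      case True
      then obtain \<tau> where "(\<sigma>, \<tau>) \<in> taylor_edges G" using A_edges by auto
      then obtain j where j: "i = Suc j" using True by (auto simp: mem_T taylor_edges_def)
      have "boundary T d j y = (\<lambda>_. 0)"
        unfolding y_def boundary_diff cyc[OF j] unfolding j boundary_boundary by simp
      then show ?thesis
        using upper_boundary_inj[of y j \<sigma>] y_notU True j by simp
    next
      case False
      then show ?thesis using y_notU yT by (auto simp: free_mod_def)
    qed
  qed
  then have "boundary T d i k = z" by (auto simp: y_def fun_eq_iff)
  then show ?thesis using k by blast
qed

text \<open>
  A cycle \<open>y\<close> of the Morse complex is lifted to the cycle \<open>y - k\<close> of the full complex, where the chain
  \<open>k\<close> of upper sets has the same boundary as \<open>y\<close>. If \<open>t\<close> bounds to \<open>y - k\<close>, then the projection of \<open>t\<close>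
  bounds to \<open>y\<close>. In degree zero the two complexes agree as the empty set is critical.
\<close>

theorem morse_resolution:
  assumes res: "free_resolution_of_quotient I T d (\<lambda>_. 1)"
    and "{} \<in> critical G A"
  shows "free_resolution_of_quotient I B Q (\<lambda>_. 1)"
proof -
  have T0: "T 0 = {{}}" by (auto simp: mem_T finite_G finite_subset[OF _ finite_G])
  have B0: "B 0 = {{}}" using assms(2) T0 by (auto simp: morse_basis_def critical_def)
  have ker_eq: "{v \<in> free_mod (T (Suc i)). boundary T d i v = (\<lambda>_. 0)}
      = boundary T d (Suc i) ` free_mod (T (Suc (Suc i)))" for i
    using res by (simp add: free_resolution_of_quotient_def)
  have im0: "{v \<in> free_mod {{}::'m set}. v {} \<in> I} = boundary T d 0 ` free_mod (T 1)"
    using res by (simp add: free_resolution_of_quotient_def T0)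
  have sq: "boundary B Q i (boundary B Q (Suc i) y) = (\<lambda>_. 0)"
    if "y \<in> free_mod (B (Suc (Suc i)))" for i y
  proof -
    have "boundary B Q i (boundary B Q (Suc i) y) = boundary B Q i (boundary B Q (Suc i) (proj (Suc (Suc i)) y))"
      using proj_critical[OF that] by simp
    also have "\<dots> = proj i (boundary T d i (boundary T d (Suc i) y))"
      by (simp add: proj_boundary)
    also have "\<dots> = (\<lambda>_. 0)" by (auto simp: boundary_boundary proj_def)
    finally show ?thesis .
  qed
  have exact: "\<exists>x\<in>free_mod (B (Suc (Suc i))). boundary B Q (Suc i) x = y"
    if y: "y \<in> free_mod (B (Suc i))" "boundary B Q i y = (\<lambda>_. 0)" for i y
  proof -
    define z where "z = boundary T d i y"
    have "z \<in> free_mod (T i)" "proj i z = (\<lambda>_. 0)"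
      using boundary_mem proj_boundary[of i y] proj_critical[OF y(1)] y(2) by (auto simp: z_def)
    moreover have "boundary T d j z = (\<lambda>_. 0)" if "i = Suc j" for j
      unfolding z_def that by (rule boundary_boundary)
    ultimately obtain k where k: "k \<in> free_mod (T (Suc i))" "\<And>\<upsilon>. \<upsilon> \<notin> Domain A \<Longrightarrow> k \<upsilon> = 0"
      "boundary T d i k = z"
      using proj_kernel_acyclic[of z i] by blast
    define x where "x = (\<lambda>\<sigma>. y \<sigma> - k \<sigma>)"
    have "x \<in> free_mod (T (Suc i))"
      using k(1) free_mod_B_T[OF y(1)] by (auto simp: x_def free_mod_def)
    moreover have "boundary T d i x = (\<lambda>_. 0)"
      unfolding x_def boundary_diff k(3) by (simp add: z_def)
    ultimately have "x \<in> boundary T d (Suc i) ` free_mod (T (Suc (Suc i)))"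
      using ker_eq[of i] by blast
    then obtain t where t: "boundary T d (Suc i) t = x" by blast
    have "proj (Suc i) k = (\<lambda>_. 0)" by (rule proj_upper) (rule k(2))
    then have "y = proj (Suc i) x"
      unfolding x_def proj_diff proj_critical[OF y(1)] by simp
    also have "\<dots> = boundary B Q (Suc i) (proj (Suc (Suc i)) t)"
      unfolding t[symmetric] by (rule proj_boundary)
    finally show ?thesis using proj_mem by metis
  qed
  have proj0: "proj 0 x = x" if "x \<in> free_mod {{}::'m set}" for x
    using proj_critical[of x 0] that B0 by simp
  have im0': "{v \<in> free_mod {{}::'m set}. v {} \<in> I} = boundary B Q 0 ` free_mod (B 1)"
  proof (intro equalityI subsetI)
    fix v assume v: "v \<in> {v \<in> free_mod {{}::'m set}. v {} \<in> I}"
    then obtain t where t: "v = boundary T d 0 t" using im0 by blast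
    then have "v = boundary B Q 0 (proj 1 t)"
      using proj0[of v] v proj_boundary[of 0 t] by simp
    then show "v \<in> boundary B Q 0 ` free_mod (B 1)" using proj_mem by auto
  next
    fix v assume "v \<in> boundary B Q 0 ` free_mod (B 1)"
    then obtain y where y: "y \<in> free_mod (B 1)" "v = boundary B Q 0 y" by auto
    have "boundary T d 0 y \<in> free_mod {{}}" using boundary_mem[of T d 0 y] T0 by simp
    then have "v = boundary T d 0 y"
      using proj_boundary[of 0 y] proj_critical[OF y(1)] proj0 y by simp
    then show "v \<in> {v \<in> free_mod {{}::'m set}. v {} \<in> I}" using im0 free_mod_B_T[OF y(1)] by blast
  qed
  show ?thesis
    unfolding free_resolution_of_quotient_def
  proof (intro conjI allI)
    show "\<exists>v\<in>free_mod (B 0). (\<Sum>b\<in>B 0. v b * 1) - s \<in> I" for s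
      using res by (simp add: free_resolution_of_quotient_def T0 B0)
    show "{v \<in> free_mod (B 0). (\<Sum>b\<in>B 0. v b * 1) \<in> I} = boundary B Q 0 ` free_mod (B 1)"
      using im0' by (simp add: B0)
    show "{v \<in> free_mod (B (Suc i)). boundary B Q i v = (\<lambda>_. 0)}
        = boundary B Q (Suc i) ` free_mod (B (Suc (Suc i)))" for i
      using exact[of _ i] sq[of _ i] boundary_mem[of B Q "Suc i"] by blast
  qed (rule finite_B)
qed

end


section \<open>The Taylor resolution\<close>

lemma mem_full_basis: "\<sigma> \<in> morse_basis G {} i \<longleftrightarrow> \<sigma> \<subseteq> G \<and> card \<sigma> = i"
  by (auto simp: morse_basis_def critical_def)

lemma mono_dvd_refl: "mono_dvd m m"
  by (simp add: mono_dvd_def)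

lemma mono_dvd_trans: "mono_dvd a b \<Longrightarrow> mono_dvd b c \<Longrightarrow> mono_dvd a c"
  unfolding mono_dvd_def using order_trans by blast

lemma mono_dvd_antisym: "mono_dvd a b \<Longrightarrow> mono_dvd b a \<Longrightarrow> a = b"
  by (auto simp: mono_dvd_def intro!: poly_mapping_eqI order_antisym)

lemma mono_dvd_add_diff: "mono_dvd a b \<Longrightarrow> a + (b - a) = b"
  by (auto simp: mono_dvd_def lookup_add lookup_minus intro!: poly_mapping_eqI)

lemma mono_dvd_diff_add: "mono_dvd a b \<Longrightarrow> (b - a) + a = b"
  by (simp add: mono_dvd_add_diff add.commute)

lemma mono_dvd_add: "mono_dvd a (a + b)" "mono_dvd a (b + a)"
  by (auto simp: mono_dvd_def lookup_add)

lemma lookup_mono_lcm: "lookup (mono_lcm \<sigma>) i = Max (insert 0 ((\<lambda>m. lookup m i) ` \<sigma>))"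
  unfolding mono_lcm_def by (subst lookup_Abs_poly_mapping) (auto intro: finite_subset[OF subset_UNIV])

lemma mono_lcm_dvd_iff:
  assumes "finite \<sigma>"
  shows "mono_dvd (mono_lcm \<sigma>) \<mu> \<longleftrightarrow> (\<forall>m\<in>\<sigma>. mono_dvd m \<mu>)"
  using assms by (auto simp: mono_dvd_def lookup_mono_lcm)

lemma dvd_mono_lcm: "finite \<sigma> \<Longrightarrow> m \<in> \<sigma> \<Longrightarrow> mono_dvd m (mono_lcm \<sigma>)"
  using mono_lcm_dvd_iff mono_dvd_refl by blast

lemma mono_lcm_mono: "finite \<sigma> \<Longrightarrow> \<tau> \<subseteq> \<sigma> \<Longrightarrow> mono_dvd (mono_lcm \<tau>) (mono_lcm \<sigma>)"
  by (subst mono_lcm_dvd_iff) (auto intro: finite_subset dvd_mono_lcm)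

lemma mono_lcm_empty: "mono_lcm {} = 0"
  by (rule poly_mapping_eqI) (simp add: lookup_mono_lcm)

lemma poly_eq_sum_single: "p = (\<Sum>k\<in>Poly_Mapping.keys p. Poly_Mapping.single k (lookup p k))"
  by (rule poly_mapping_eqI) (auto simp: lookup_sum lookup_single when_def in_keys_iff)

lemma lookup_times_monom:
  fixes p :: "('n, 'k::field) polys"
  shows "lookup (p * monom a) b = (if mono_dvd a b then lookup p (b - a) else 0)"
proof -
  have "p * monom a = (\<Sum>k\<in>Poly_Mapping.keys p. Poly_Mapping.single (k + a) (lookup p k))"
    by (subst poly_eq_sum_single[of p]) (simp add: sum_distrib_right monom_def mult_single)
  then have "lookup (p * monom a) b = (\<Sum>k\<in>Poly_Mapping.keys p. lookup p k when k + a = b)"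
    by (simp add: lookup_sum lookup_single)
  also have "\<dots> = (if mono_dvd a b then lookup p (b - a) else 0)"
  proof (cases "mono_dvd a b")
    case True
    have "k + a = b \<longleftrightarrow> k = b - a" for k
      using mono_dvd_diff_add[OF True] by auto
    then show ?thesis using True by (auto simp: when_def in_keys_iff)
  next
    case False
    then have "k + a \<noteq> b" for k using mono_dvd_add(2) by blast
    then show ?thesis using False by simp
  qed
  finally show ?thesis .
qed

lemma monom_add: "monom (a + b) = monom a * monom b"
  by (simp add: monom_def mult_single)

definition taylor_sign :: "'m rel \<Rightarrow> 'm set \<Rightarrow> 'm \<Rightarrow> 'k::comm_ring_1" where
  "taylor_sign r \<sigma> m = (-1) ^ card {m' \<in> \<sigma>. m' \<noteq> m \<and> (m', m) \<in> r}"

lemma taylor_sign_square: "taylor_sign r \<sigma> m * taylor_sign r \<sigma> m = (1 :: 'k::comm_ring_1)"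
  unfolding taylor_sign_def power_mult_distrib[symmetric] by simp

text \<open>
  Removing \<open>a\<close> changes the sign at \<open>b\<close> exactly if \<open>a\<close> precedes \<open>b\<close>, and exactly one of \<open>a\<close> and \<open>b\<close>
  precedes the other.
\<close>

lemma taylor_sign_anticommute:
  assumes r: "linear_order_on G r" and "\<sigma> \<subseteq> G" "finite \<sigma>" "a \<in> \<sigma>" "b \<in> \<sigma>" "a \<noteq> b"
  shows "(taylor_sign r \<sigma> a * taylor_sign r (\<sigma> - {a}) b :: 'k::comm_ring_1)
       = - (taylor_sign r \<sigma> b * taylor_sign r (\<sigma> - {b}) a)"
proof -
  have step: "taylor_sign r \<sigma> b = (if (a, b) \<in> r then - 1 else 1) * (taylor_sign r (\<sigma> - {a}) b :: 'k)"
    if "a \<in> \<sigma>" "a \<noteq> b" for a b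
  proof (cases "(a, b) \<in> r")
    case True
    have "{m' \<in> \<sigma>. m' \<noteq> b \<and> (m', b) \<in> r} = insert a {m' \<in> \<sigma> - {a}. m' \<noteq> b \<and> (m', b) \<in> r}"
      using that True by auto
    then show ?thesis using True \<open>finite \<sigma>\<close> by (simp add: taylor_sign_def)
  next
    case False
    then have "{m' \<in> \<sigma>. m' \<noteq> b \<and> (m', b) \<in> r} = {m' \<in> \<sigma> - {a}. m' \<noteq> b \<and> (m', b) \<in> r}"
      by auto
    then show ?thesis using False by (simp add: taylor_sign_def)
  qed
  have "(a, b) \<in> r \<longleftrightarrow> (b, a) \<notin> r"
  proof -
    have "a \<in> G" "b \<in> G" using assms by auto
    then show ?thesis using r \<open>a \<noteq> b\<close>
      by (auto simp: linear_order_on_def partial_order_on_def total_on_def antisym_def)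
  qed
  then show ?thesis
    unfolding step[OF assms(4,6)] step[OF assms(5) assms(6)[symmetric]] by auto
qed

text \<open>
  \<open>taylor_coeff\<close> is meaningful only on edges; off the edges a matrix entry has to vanish.
\<close>

definition taylor_matrix ::
    "('n::finite) mono rel \<Rightarrow> 'n mono set \<Rightarrow> 'n mono set \<Rightarrow> 'n mono set \<Rightarrow> ('n, 'k::field) polys" where
  "taylor_matrix r G \<sigma> \<tau> = (if (\<sigma>, \<tau>) \<in> taylor_edges G then taylor_coeff r \<sigma> \<tau> else 0)"

lemma taylor_coeff_insert:
  assumes "m \<notin> \<tau>"
  shows "taylor_coeff r (insert m \<tau>) \<tau>
       = taylor_sign r (insert m \<tau>) m * monom (mono_lcm (insert m \<tau>) - mono_lcm \<tau>)"
proof -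
  have "insert m \<tau> - \<tau> = {m}" using assms by auto
  then show ?thesis by (simp add: taylor_coeff_def taylor_sign_def)
qed

lemma taylor_edge_insert:
  assumes "finite G"
  shows "(\<sigma>, \<tau>) \<in> taylor_edges G \<longleftrightarrow> (\<exists>m\<in>G - \<tau>. \<tau> \<subseteq> G \<and> \<sigma> = insert m \<tau>)"
proof
  assume a: "(\<sigma>, \<tau>) \<in> taylor_edges G"
  have fin: "finite \<sigma>" "finite \<tau>"
    using taylor_edgesD[OF a] assms finite_subset by blast+
  then have "card (\<sigma> - \<tau>) = 1"
    using taylor_edgesD[OF a] by (simp add: card_Diff_subset psubset_imp_subset)
  then obtain m where "\<sigma> - \<tau> = {m}" by (rule card_1_singletonE)
  then show "\<exists>m\<in>G - \<tau>. \<tau> \<subseteq> G \<and> \<sigma> = insert m \<tau>"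
    using taylor_edgesD[OF a] by (intro bexI[of _ m]) auto
next
  assume "\<exists>m\<in>G - \<tau>. \<tau> \<subseteq> G \<and> \<sigma> = insert m \<tau>"
  then show "(\<sigma>, \<tau>) \<in> taylor_edges G"
    using finite_subset[OF _ assms] by (auto simp: taylor_edges_def)
qed

lemma taylor_matrix_insert:
  assumes "finite G" "m \<in> G - \<tau>" "\<tau> \<subseteq> G"
  shows "(taylor_matrix r G (insert m \<tau>) \<tau> :: ('n::finite, 'k::field) polys)
       = taylor_sign r (insert m \<tau>) m * monom (mono_lcm (insert m \<tau>) - mono_lcm \<tau>)"
proof -
  have "(insert m \<tau>, \<tau>) \<in> taylor_edges G" using assms taylor_edge_insert[OF assms(1)] by auto
  then show ?thesis using taylor_coeff_insert[of m \<tau> r] assms by (simp add: taylor_matrix_def)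
qed

lemma boundary_taylor:
  assumes "finite G" "\<tau> \<in> morse_basis G {} i"
  shows "boundary (morse_basis G {}) (taylor_matrix r G) i x \<tau>
       = (\<Sum>m\<in>G - \<tau>. x (insert m \<tau>) * taylor_matrix r G (insert m \<tau>) \<tau>)"
proof -
  have \<tau>: "\<tau> \<subseteq> G" "card \<tau> = i" using assms(2) by (auto simp: mem_full_basis)
  have fin\<tau>: "finite \<tau>" using \<tau> assms finite_subset by blast
  have "boundary (morse_basis G {}) (taylor_matrix r G) i x \<tau>
      = (\<Sum>\<sigma>\<in>morse_basis G {} (Suc i). x \<sigma> * taylor_matrix r G \<sigma> \<tau>)"
    using assms(2) by (simp add: boundary_def)
  also have "\<dots> = (\<Sum>\<sigma>\<in>(\<lambda>m. insert m \<tau>) ` (G - \<tau>). x \<sigma> * taylor_matrix r G \<sigma> \<tau>)"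
  proof (rule sum.mono_neutral_right)
    show "finite (morse_basis G {} (Suc i))"
      by (rule finite_subset[of _ "Pow G"]) (auto simp: mem_full_basis assms)
    show "(\<lambda>m. insert m \<tau>) ` (G - \<tau>) \<subseteq> morse_basis G {} (Suc i)"
      using \<tau> fin\<tau> by (auto simp: mem_full_basis)
    show "\<forall>\<sigma>\<in>morse_basis G {} (Suc i) - (\<lambda>m. insert m \<tau>) ` (G - \<tau>). x \<sigma> * taylor_matrix r G \<sigma> \<tau> = 0"
      using taylor_edge_insert[OF assms(1)] by (auto simp: taylor_matrix_def)
  qed
  also have "\<dots> = (\<Sum>m\<in>G - \<tau>. x (insert m \<tau>) * taylor_matrix r G (insert m \<tau>) \<tau>)"
    by (subst sum.reindex) (auto simp: inj_on_def)
  finally show ?thesis .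
qed

lemma lookup_sign_times:
  fixes p :: "('n, 'k::field) polys"
  shows "lookup (p * taylor_sign r \<sigma> m) b = taylor_sign r \<sigma> m * lookup p b"
  unfolding taylor_sign_def
  by (cases "even (card {m' \<in> \<sigma>. m' \<noteq> m \<and> (m', m) \<in> r})") simp_all

text \<open>
  The coefficient of \<open>x\<close> at the basis element \<open>\<sigma>\<close> in multidegree \<open>\<mu>\<close>, where \<open>\<sigma>\<close> itself has
  multidegree \<open>mono_lcm \<sigma>\<close>.
\<close>

definition strand :: "(('n::finite) mono set \<Rightarrow> ('n, 'k::field) polys) \<Rightarrow> 'n mono set \<Rightarrow> 'n mono \<Rightarrow> 'k" where
  "strand x \<sigma> \<mu> = (if mono_dvd (mono_lcm \<sigma>) \<mu> then lookup (x \<sigma>) (\<mu> - mono_lcm \<sigma>) else 0)"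

text \<open>
  In a fixed multidegree the Taylor differential loses its monomials and becomes the simplicial
  boundary map over the field.
\<close>

lemma strand_boundary:
  fixes x :: "('n::finite) mono set \<Rightarrow> ('n, 'k::field) polys"
  assumes "finite G" "\<tau> \<in> morse_basis G {} i"
  shows "strand (boundary (morse_basis G {}) (taylor_matrix r G) i x) \<tau> \<mu>
       = (\<Sum>m\<in>G - \<tau>. taylor_sign r (insert m \<tau>) m * strand x (insert m \<tau>) \<mu>)"
proof -
  have \<tau>: "\<tau> \<subseteq> G" using assms(2) by (auto simp: mem_full_basis)
  have fin: "finite (insert m \<tau>)" for m using \<tau> assms finite_subset by auto
  have dvd: "mono_dvd (mono_lcm \<tau>) (mono_lcm (insert m \<tau>))" for m
    by (rule mono_lcm_mono) (use fin in auto)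
  show ?thesis
  proof (cases "mono_dvd (mono_lcm \<tau>) \<mu>")
    case False
    then have "\<not> mono_dvd (mono_lcm (insert m \<tau>)) \<mu>" for m
      using dvd mono_dvd_trans by blast
    then show ?thesis using False by (simp add: strand_def)
  next
    case True
    have summand: "lookup (x (insert m \<tau>) * taylor_matrix r G (insert m \<tau>) \<tau>) (\<mu> - mono_lcm \<tau>)
        = taylor_sign r (insert m \<tau>) m * strand x (insert m \<tau>) \<mu>" if m: "m \<in> G - \<tau>" for m
    proof -
      define a where "a = mono_lcm (insert m \<tau>)"
      have le: "lookup (mono_lcm \<tau>) i \<le> lookup \<mu> i" "lookup (mono_lcm \<tau>) i \<le> lookup a i" for i
        using True dvd[of m] by (auto simp: mono_dvd_def a_def)
      have "mono_dvd (a - mono_lcm \<tau>) (\<mu> - mono_lcm \<tau>) \<longleftrightarrow> mono_dvd a \<mu>"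
        using le by (simp add: mono_dvd_def lookup_minus)
          (meson diff_le_mono le_diff_iff)
      moreover have "(\<mu> - mono_lcm \<tau>) - (a - mono_lcm \<tau>) = \<mu> - a"
        using le by (intro poly_mapping_eqI) (simp add: lookup_minus)
      ultimately show ?thesis
        unfolding taylor_matrix_insert[OF assms(1) m \<tau>] mult.assoc[symmetric] lookup_times_monom
        by (simp add: lookup_sign_times strand_def a_def)
    qed
    show ?thesis
      using True summand by (simp add: strand_def[of "boundary _ _ _ _"] boundary_taylor[OF assms] lookup_sum)
  qed
qed

lemma strand_eqI:
  assumes "\<And>\<mu>. strand x \<sigma> \<mu> = strand y \<sigma> \<mu>"
  shows "x \<sigma> = y \<sigma>"
proof (rule poly_mapping_eqI)
  fix b
  show "lookup (x \<sigma>) b = lookup (y \<sigma>) b"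
    using assms[of "b + mono_lcm \<sigma>"] mono_dvd_add(2)[of "mono_lcm \<sigma>" b] by (simp add: strand_def)
qed

lemma taylor_matrix_square:
  assumes r: "linear_order_on G r" and G: "finite G"
    and \<upsilon>: "\<upsilon> \<in> morse_basis G {} (Suc (Suc i))" and \<tau>: "\<tau> \<in> morse_basis G {} i"
  shows "(\<Sum>\<sigma>\<in>morse_basis G {} (Suc i). taylor_matrix r G \<upsilon> \<sigma> * taylor_matrix r G \<sigma> \<tau>)
       = (0 :: ('n::finite, 'k::field) polys)"
proof (cases "\<tau> \<subseteq> \<upsilon>")
  case False
  have "taylor_matrix r G \<upsilon> \<sigma> * taylor_matrix r G \<sigma> \<tau> = (0 :: ('n, 'k) polys)" for \<sigma>
    using False by (auto simp: taylor_matrix_def taylor_edges_def)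
  then show ?thesis by simp
next
  case True
  have fin: "finite \<upsilon>" "\<upsilon> \<subseteq> G" "\<tau> \<subseteq> G"
    using \<upsilon> \<tau> G finite_subset by (auto simp: mem_full_basis)
  have "card (\<upsilon> - \<tau>) = 2"
    using \<upsilon> \<tau> True fin by (subst card_Diff_subset) (auto simp: mem_full_basis intro: finite_subset)
  then obtain a b where ab: "\<upsilon> - \<tau> = {a, b}" "a \<noteq> b" by (meson card_2_iff)
  have summand: "taylor_matrix r G \<upsilon> (\<upsilon> - {a}) * taylor_matrix r G (\<upsilon> - {a}) \<tau>
      = taylor_sign r \<upsilon> a * taylor_sign r (\<upsilon> - {a}) b * (monom (mono_lcm \<upsilon> - mono_lcm \<tau>) :: ('n, 'k) polys)"
    if ab: "\<upsilon> - \<tau> = {a, b}" "a \<noteq> b" for a b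
  proof -
    have eq: "insert a (\<upsilon> - {a}) = \<upsilon>" "insert b \<tau> = \<upsilon> - {a}" using ab True by auto
    have mem: "a \<in> G - (\<upsilon> - {a})" "\<upsilon> - {a} \<subseteq> G" "b \<in> G - \<tau>" using ab fin by auto
    have dvd: "mono_dvd (mono_lcm (\<upsilon> - {a})) (mono_lcm \<upsilon>)" "mono_dvd (mono_lcm \<tau>) (mono_lcm (\<upsilon> - {a}))"
      using fin eq by (auto intro!: mono_lcm_mono)
    then have "mono_lcm \<upsilon> - mono_lcm \<tau>
        = (mono_lcm \<upsilon> - mono_lcm (\<upsilon> - {a})) + (mono_lcm (\<upsilon> - {a}) - mono_lcm \<tau>)"
      by (intro poly_mapping_eqI) (auto simp: lookup_add lookup_minus mono_dvd_def)
    then show ?thesis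
      using taylor_matrix_insert[OF G mem(1,2), of r, where 'k='k]
        taylor_matrix_insert[OF G mem(3) fin(3), of r, where 'k='k]
      unfolding eq by (simp add: monom_add algebra_simps)
  qed
  have "(\<Sum>\<sigma>\<in>morse_basis G {} (Suc i). taylor_matrix r G \<upsilon> \<sigma> * taylor_matrix r G \<sigma> \<tau>)
      = (\<Sum>\<sigma>\<in>{\<upsilon> - {a}, \<upsilon> - {b}}. taylor_matrix r G \<upsilon> \<sigma> * taylor_matrix r G \<sigma> \<tau> :: ('n, 'k) polys)"
  proof (rule sum.mono_neutral_right)
    show "finite (morse_basis G {} (Suc i))"
      by (rule finite_subset[of _ "Pow G"]) (auto simp: mem_full_basis G)
    show "{\<upsilon> - {a}, \<upsilon> - {b}} \<subseteq> morse_basis G {} (Suc i)"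
    proof -
      have "a \<in> \<upsilon>" "b \<in> \<upsilon>" using ab by auto
      then show ?thesis using \<upsilon> fin by (auto simp: mem_full_basis)
    qed
    show "\<forall>\<sigma>\<in>morse_basis G {} (Suc i) - {\<upsilon> - {a}, \<upsilon> - {b}}.
        taylor_matrix r G \<upsilon> \<sigma> * taylor_matrix r G \<sigma> \<tau> = (0 :: ('n, 'k) polys)"
    proof
      fix \<sigma> assume \<sigma>: "\<sigma> \<in> morse_basis G {} (Suc i) - {\<upsilon> - {a}, \<upsilon> - {b}}"
      have "\<not> ((\<upsilon>, \<sigma>) \<in> taylor_edges G \<and> (\<sigma>, \<tau>) \<in> taylor_edges G)"
      proof
        assume e: "(\<upsilon>, \<sigma>) \<in> taylor_edges G \<and> (\<sigma>, \<tau>) \<in> taylor_edges G"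
        then obtain m where m: "m \<notin> \<sigma>" "\<upsilon> = insert m \<sigma>" using taylor_edge_insert[OF G] by blast
        moreover have "m \<notin> \<tau>" using e m(1) by (auto simp: taylor_edges_def)
        ultimately have "m = a \<or> m = b" using ab by auto
        then show False using m \<sigma> by auto
      qed
      then show "taylor_matrix r G \<upsilon> \<sigma> * taylor_matrix r G \<sigma> \<tau> = (0 :: ('n, 'k) polys)"
        by (auto simp: taylor_matrix_def)
    qed
  qed
  also have "\<dots> = 0"
  proof -
    have "\<upsilon> - {a} \<noteq> \<upsilon> - {b}" "a \<in> \<upsilon>" "b \<in> \<upsilon>" using ab by auto
    moreover have "\<upsilon> - \<tau> = {b, a}" using ab by auto
    ultimately show ?thesis
      using summand[OF ab] summand[of b a] ab(2)
        taylor_sign_anticommute[OF r fin(2,1) \<open>a \<in> \<upsilon>\<close> \<open>b \<in> \<upsilon>\<close> ab(2), where 'k="('n, 'k) polys"]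
      by simp
  qed
  finally show ?thesis .
qed

lemma finite_full_basis: "finite G \<Longrightarrow> finite (morse_basis G {} i)"
  by (rule finite_subset[of _ "Pow G"]) (auto simp: mem_full_basis)

text \<open>
  In multidegree \<open>\<mu>\<close> the strand is the augmented chain complex of the full simplex on the generators
  dividing \<open>\<mu>\<close>. It is contracted to one of them, \<open>v \<mu>\<close>: a cycle is the boundary of the cone over it
  with apex \<open>v \<mu>\<close>.
\<close>

lemma taylor_exact:
  fixes x :: "('n::finite) mono set \<Rightarrow> ('n, 'k::field) polys"
  assumes r: "linear_order_on G r" and G: "finite G"
    and x: "x \<in> free_mod (morse_basis G {} i)"
    and cyc: "\<And>j. i = Suc j \<Longrightarrow> boundary (morse_basis G {}) (taylor_matrix r G) j x = (\<lambda>_. 0)"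
    and gen: "\<And>\<sigma> \<mu>. \<sigma> \<in> morse_basis G {} i \<Longrightarrow> strand x \<sigma> \<mu> \<noteq> 0 \<Longrightarrow> \<exists>g\<in>G. mono_dvd g \<mu>"
  shows "\<exists>y\<in>free_mod (morse_basis G {} (Suc i)). boundary (morse_basis G {}) (taylor_matrix r G) i y = x"
proof -
  \<comment> \<open>the apex of the cone in multidegree \<open>\<mu>\<close>; arbitrary where nothing has to be bounded\<close>
  define v where "v = (\<lambda>\<mu>. SOME g. g \<in> G \<and> mono_dvd g \<mu>)"
  have v: "v \<mu> \<in> G" "mono_dvd (v \<mu>) \<mu>" if "\<sigma> \<in> morse_basis G {} i" "strand x \<sigma> \<mu> \<noteq> 0" for \<sigma> \<mu>
    using someI_ex[of "\<lambda>g. g \<in> G \<and> mono_dvd g \<mu>"] gen[OF that] by (auto simp: v_def)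
  have x0: "strand x \<sigma> \<mu> = 0" if "\<sigma> \<notin> morse_basis G {} i" for \<sigma> \<mu>
    using x that by (simp add: strand_def free_mod_def)
  \<comment> \<open>the cone over \<open>x\<close>, strand by strand; its strands are then collected into polynomials\<close>
  define w where "w = (\<lambda>\<sigma> \<mu>. if v \<mu> \<in> \<sigma> then taylor_sign r \<sigma> (v \<mu>) * strand x (\<sigma> - {v \<mu>}) \<mu> else 0)"
  define y where "y = (\<lambda>\<sigma>. if \<sigma> \<in> morse_basis G {} (Suc i)
     then Abs_poly_mapping (\<lambda>b. w \<sigma> (b + mono_lcm \<sigma>)) else 0)"
  have fin: "finite {b. w \<sigma> (b + mono_lcm \<sigma>) \<noteq> 0}" if "\<sigma> \<in> morse_basis G {} (Suc i)" for \<sigma>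
  proof (rule finite_subset)
    have "finite \<sigma>" using that G finite_subset by (auto simp: mem_full_basis)
    moreover have "finite {b. lookup (x (\<sigma> - {g})) (b + mono_lcm \<sigma> - mono_lcm (\<sigma> - {g})) \<noteq> 0}" for g
    proof -
      have dvd: "mono_dvd (mono_lcm (\<sigma> - {g})) (mono_lcm \<sigma>)"
        using \<open>finite \<sigma>\<close> by (intro mono_lcm_mono) auto
      have "b + mono_lcm \<sigma> - mono_lcm (\<sigma> - {g}) = b + (mono_lcm \<sigma> - mono_lcm (\<sigma> - {g}))" for b
        using dvd by (intro poly_mapping_eqI) (simp add: lookup_add lookup_minus mono_dvd_def)
      then have "inj (\<lambda>b. b + mono_lcm \<sigma> - mono_lcm (\<sigma> - {g}))" by (simp add: inj_on_def)
      then have "finite ((\<lambda>b. b + mono_lcm \<sigma> - mono_lcm (\<sigma> - {g})) -` {c. lookup (x (\<sigma> - {g})) c \<noteq> 0})"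
        by (intro finite_vimageI) simp_all
      then show ?thesis by (simp add: vimage_def)
    qed
    ultimately show "finite (\<Union>g\<in>\<sigma>. {b. lookup (x (\<sigma> - {g})) (b + mono_lcm \<sigma> - mono_lcm (\<sigma> - {g})) \<noteq> 0})"
      by blast
    show "{b. w \<sigma> (b + mono_lcm \<sigma>) \<noteq> 0}
        \<subseteq> (\<Union>g\<in>\<sigma>. {b. lookup (x (\<sigma> - {g})) (b + mono_lcm \<sigma> - mono_lcm (\<sigma> - {g})) \<noteq> 0})"
    proof
      fix b assume "b \<in> {b. w \<sigma> (b + mono_lcm \<sigma>) \<noteq> 0}"
      then have "v (b + mono_lcm \<sigma>) \<in> \<sigma>" "strand x (\<sigma> - {v (b + mono_lcm \<sigma>)}) (b + mono_lcm \<sigma>) \<noteq> 0"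
        by (auto simp: w_def split: if_splits)
      then show "b \<in> (\<Union>g\<in>\<sigma>. {b. lookup (x (\<sigma> - {g})) (b + mono_lcm \<sigma> - mono_lcm (\<sigma> - {g})) \<noteq> 0})"
        by (auto simp: strand_def split: if_splits intro!: bexI[of _ "v (b + mono_lcm \<sigma>)"])
    qed
  qed
  have strand_y: "strand y \<sigma> \<mu> = w \<sigma> \<mu>" if \<sigma>: "\<sigma> \<in> morse_basis G {} (Suc i)" for \<sigma> \<mu>
  proof (cases "mono_dvd (mono_lcm \<sigma>) \<mu>")
    case True
    then show ?thesis
      using \<sigma> fin[OF \<sigma>] by (simp add: strand_def y_def lookup_Abs_poly_mapping mono_dvd_diff_add)
  next
    case False
    have fin\<sigma>: "finite \<sigma>" using \<sigma> G finite_subset by (auto simp: mem_full_basis)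
    have "w \<sigma> \<mu> = 0"
    proof (rule ccontr)
      assume "w \<sigma> \<mu> \<noteq> 0"
      then have *: "v \<mu> \<in> \<sigma>" "strand x (\<sigma> - {v \<mu>}) \<mu> \<noteq> 0" by (auto simp: w_def split: if_splits)
      then have "mono_dvd (mono_lcm (\<sigma> - {v \<mu>})) \<mu>" by (auto simp: strand_def split: if_splits)
      moreover have "mono_dvd (v \<mu>) \<mu>" using v(2)[OF _ *(2)] x0 *(2) by blast
      ultimately have "\<forall>m\<in>\<sigma>. mono_dvd m \<mu>" using mono_lcm_dvd_iff[of "\<sigma> - {v \<mu>}"] fin\<sigma> by auto
      then show False using False mono_lcm_dvd_iff[OF fin\<sigma>] by blast
    qed
    then show ?thesis using False by (simp add: strand_def)
  qed
  have "boundary (morse_basis G {}) (taylor_matrix r G) i y = x"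
  proof
    fix \<tau>
    show "boundary (morse_basis G {}) (taylor_matrix r G) i y \<tau> = x \<tau>"
    proof (cases "\<tau> \<in> morse_basis G {} i")
      case False
      then show ?thesis using x by (simp add: boundary_def free_mod_def)
    next
      case \<tau>: True
      have \<tau>G: "\<tau> \<subseteq> G" "finite \<tau>" using \<tau> G finite_subset by (auto simp: mem_full_basis)
      have ins: "insert m \<tau> \<in> morse_basis G {} (Suc i)" if "m \<in> G - \<tau>" for m
        using \<tau> \<tau>G that by (simp add: mem_full_basis)
      show ?thesis
      proof (rule strand_eqI)
        fix \<mu>
        have bd: "strand (boundary (morse_basis G {}) (taylor_matrix r G) i y) \<tau> \<mu>
            = (\<Sum>m\<in>G - \<tau>. taylor_sign r (insert m \<tau>) m * w (insert m \<tau>) \<mu>)"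
          unfolding strand_boundary[OF G \<tau>] by (rule sum.cong) (simp_all add: strand_y ins)
        let ?g = "v \<mu>"
        show "strand (boundary (morse_basis G {}) (taylor_matrix r G) i y) \<tau> \<mu> = strand x \<tau> \<mu>"
        proof (cases "?g \<in> \<tau>")
          case False
          have "(\<Sum>m\<in>G - \<tau>. taylor_sign r (insert m \<tau>) m * w (insert m \<tau>) \<mu>)
              = (\<Sum>m\<in>G - \<tau>. if m = ?g then strand x \<tau> \<mu> else 0)"
          proof (rule sum.cong[OF refl])
            fix m assume "m \<in> G - \<tau>"
            then show "taylor_sign r (insert m \<tau>) m * w (insert m \<tau>) \<mu> = (if m = ?g then strand x \<tau> \<mu> else 0)"
              using False taylor_sign_square[of r "insert m \<tau>" m, where 'k='k]
              by (auto simp: w_def mult.assoc[symmetric])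
          qed
          also have "\<dots> = strand x \<tau> \<mu>" using v(1)[OF \<tau>, of \<mu>] False G by auto
          finally show ?thesis using bd by simp
        next
          case True
          obtain j where j: "i = Suc j" using True \<tau> \<tau>G by (cases i) (auto simp: mem_full_basis)
          \<comment> \<open>the cycle condition for \<open>x\<close> is used at the face of \<open>\<tau>\<close> opposite to the apex\<close>
          define \<rho> where "\<rho> = \<tau> - {?g}"
          have \<rho>: "\<rho> \<in> morse_basis G {} j" using \<tau> \<tau>G True j by (simp add: \<rho>_def mem_full_basis subset_insertI2 Diff_subset[THEN subset_trans])
          have \<tau>_eq: "insert ?g \<rho> = \<tau>" "?g \<notin> \<rho>" using True by (auto simp: \<rho>_def)
          have "0 = strand (boundary (morse_basis G {}) (taylor_matrix r G) j x) \<rho> \<mu>"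
            unfolding cyc[OF j] by (simp add: strand_def)
          also have "\<dots> = (\<Sum>m\<in>G - \<rho>. taylor_sign r (insert m \<rho>) m * strand x (insert m \<rho>) \<mu>)"
            by (rule strand_boundary[OF G \<rho>])
          also have "G - \<rho> = insert ?g (G - \<tau>)" using True \<tau>G by (auto simp: \<rho>_def)
          also have "(\<Sum>m\<in>insert ?g (G - \<tau>). taylor_sign r (insert m \<rho>) m * strand x (insert m \<rho>) \<mu>)
              = taylor_sign r \<tau> ?g * strand x \<tau> \<mu>
                + (\<Sum>m\<in>G - \<tau>. taylor_sign r (insert m \<rho>) m * strand x (insert m \<rho>) \<mu>)"
            using G True by (simp add: \<tau>_eq)
          finally have cycle: "(\<Sum>m\<in>G - \<tau>. taylor_sign r (insert m \<rho>) m * strand x (insert m \<rho>) \<mu>)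
              = - (taylor_sign r \<tau> ?g * strand x \<tau> \<mu>)"
            by (simp add: eq_neg_iff_add_eq_0 add.commute)
          have "(\<Sum>m\<in>G - \<tau>. taylor_sign r (insert m \<tau>) m * w (insert m \<tau>) \<mu>)
              = (\<Sum>m\<in>G - \<tau>. - taylor_sign r \<tau> ?g * (taylor_sign r (insert m \<rho>) m * strand x (insert m \<rho>) \<mu>))"
          proof (rule sum.cong[OF refl])
            fix m assume m: "m \<in> G - \<tau>"
            have eq: "insert m \<tau> - {?g} = insert m \<rho>" "insert m \<tau> - {m} = \<tau>" using m True by (auto simp: \<rho>_def)
            have sub: "insert m \<tau> \<subseteq> G" "finite (insert m \<tau>)" "m \<in> insert m \<tau>" "?g \<in> insert m \<tau>" "m \<noteq> ?g"
              using m True \<tau>G by auto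
            define s1 s2 s3 s4 :: 'k where "s1 = taylor_sign r (insert m \<tau>) m"
              and "s2 = taylor_sign r (insert m \<tau>) ?g" and "s3 = taylor_sign r \<tau> ?g"
              and "s4 = taylor_sign r (insert m \<rho>) m"
            have anti: "s1 * s3 = - (s2 * s4)"
              using taylor_sign_anticommute[OF r sub, where 'k='k] by (simp add: eq s1_def s2_def s3_def s4_def)
            have sq: "s3 * s3 = 1" "s2 * s2 = 1"
              unfolding s2_def s3_def by (rule taylor_sign_square)+
            have "s1 * s2 = s1 * s3 * s3 * s2" using sq by (simp add: mult.assoc)
            also have "\<dots> = - (s2 * s2) * s4 * s3" unfolding anti by (simp add: algebra_simps)
            finally have "s1 * s2 = - s3 * s4" using sq by (simp add: algebra_simps)
            then show "taylor_sign r (insert m \<tau>) m * w (insert m \<tau>) \<mu>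
                = - taylor_sign r \<tau> ?g * (taylor_sign r (insert m \<rho>) m * strand x (insert m \<rho>) \<mu>)"
              using True by (simp add: w_def eq s1_def s2_def s3_def s4_def mult.assoc[symmetric])
          qed
          also have "\<dots> = - taylor_sign r \<tau> ?g * (- (taylor_sign r \<tau> ?g * strand x \<tau> \<mu>))"
            unfolding sum_distrib_left[symmetric] cycle ..
          also have "\<dots> = strand x \<tau> \<mu>"
            using taylor_sign_square[of r \<tau> ?g, where 'k='k] by (simp add: mult.assoc[symmetric])
          finally show ?thesis using bd by simp
        qed
      qed
    qed
  qed
  moreover have "y \<in> free_mod (morse_basis G {} (Suc i))" by (simp add: y_def free_mod_def)
  ultimately show ?thesis by blast
qed

theorem taylor_resolution:
  fixes I :: "('n::finite, 'k::field) polys set"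
  assumes r: "linear_order_on G r" and G: "finite G"
    and I: "I = {p. \<forall>\<mu>\<in>Poly_Mapping.keys p. \<exists>g\<in>G. mono_dvd g \<mu>}"
  shows "free_resolution_of_quotient I (morse_basis G {}) (taylor_matrix r G) (\<lambda>_. 1)"
proof -
  let ?T = "morse_basis G {}" and ?d = "taylor_matrix r G :: _ \<Rightarrow> _ \<Rightarrow> ('n, 'k) polys"
  have T0: "?T 0 = {{}}"
    using finite_subset[OF _ G] by (fastforce simp: mem_full_basis)
  have strand0: "strand v {} \<mu> = lookup (v {}) \<mu>" for v :: "'n mono set \<Rightarrow> ('n, 'k) polys" and \<mu>
    by (simp add: strand_def mono_lcm_empty mono_dvd_def)
  have sq: "boundary ?T ?d i (boundary ?T ?d (Suc i) x) = (\<lambda>_. 0)" for i x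
    by (rule boundary_boundary_eq_0) (rule taylor_matrix_square[OF r G])
  show ?thesis
    unfolding free_resolution_of_quotient_def
  proof (intro conjI allI)
    show "finite (?T i)" for i by (rule finite_full_basis[OF G])
    show "\<exists>v\<in>free_mod (?T 0). (\<Sum>b\<in>?T 0. v b * 1) - s \<in> I" for s
      by (rule bexI[of _ "\<lambda>b. if b = {} then s else 0"]) (simp_all add: T0 free_mod_def I)
    show "{v \<in> free_mod (?T 0). (\<Sum>b\<in>?T 0. v b * 1) \<in> I} = boundary ?T ?d 0 ` free_mod (?T 1)"
    proof (intro equalityI subsetI)
      fix v assume v: "v \<in> {v \<in> free_mod (?T 0). (\<Sum>b\<in>?T 0. v b * 1) \<in> I}"
      have "\<exists>y\<in>free_mod (?T (Suc 0)). boundary ?T ?d 0 y = v"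
        using v by (intro taylor_exact[OF r G]) (auto simp: T0 strand0 I in_keys_iff)
      then show "v \<in> boundary ?T ?d 0 ` free_mod (?T 1)" by auto
    next
      fix v assume "v \<in> boundary ?T ?d 0 ` free_mod (?T 1)"
      then obtain y where y: "y \<in> free_mod (?T 1)" "v = boundary ?T ?d 0 y" by auto
      have "\<exists>g\<in>G. mono_dvd g \<mu>" if \<mu>: "lookup (v {}) \<mu> \<noteq> 0" for \<mu>
      proof -
        have "(\<Sum>m\<in>G - {}. taylor_sign r (insert m {}) m * strand y (insert m {}) \<mu>) \<noteq> 0"
          using \<mu> strand_boundary[OF G, of "{}" 0 r y \<mu>] by (simp add: strand0 y T0)
        then obtain m where "m \<in> G" "strand y {m} \<mu> \<noteq> 0"
          by (metis (no_types, lifting) DiffD1 mult_zero_right sum.neutral)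
        moreover from this have "mono_dvd (mono_lcm {m}) \<mu>" by (auto simp: strand_def split: if_splits)
        ultimately show ?thesis using mono_lcm_dvd_iff[of "{m}" \<mu>] by auto
      qed
      moreover have "v \<in> free_mod (?T 0)" unfolding y by (rule boundary_mem)
      ultimately show "v \<in> {v \<in> free_mod (?T 0). (\<Sum>b\<in>?T 0. v b * 1) \<in> I}"
        by (simp add: T0 I in_keys_iff)
    qed
    show "{v \<in> free_mod (?T (Suc i)). boundary ?T ?d i v = (\<lambda>_. 0)}
        = boundary ?T ?d (Suc i) ` free_mod (?T (Suc (Suc i)))" for i
    proof (intro equalityI subsetI)
      fix v assume v: "v \<in> {v \<in> free_mod (?T (Suc i)). boundary ?T ?d i v = (\<lambda>_. 0)}"
      have "\<exists>y\<in>free_mod (?T (Suc (Suc i))). boundary ?T ?d (Suc i) y = v"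
      proof (rule taylor_exact[OF r G])
        fix \<sigma> \<mu> assume \<sigma>: "\<sigma> \<in> ?T (Suc i)" "strand v \<sigma> \<mu> \<noteq> 0"
        then have "\<sigma> \<noteq> {}" "\<sigma> \<subseteq> G" "finite \<sigma>" using G finite_subset by (auto simp: mem_full_basis)
        moreover have "mono_dvd (mono_lcm \<sigma>) \<mu>" using \<sigma> by (auto simp: strand_def split: if_splits)
        ultimately show "\<exists>g\<in>G. mono_dvd g \<mu>" using mono_lcm_dvd_iff[of \<sigma> \<mu>] by blast
      qed (use v in auto)
      then show "v \<in> boundary ?T ?d (Suc i) ` free_mod (?T (Suc (Suc i)))" by auto
    next
      fix v assume "v \<in> boundary ?T ?d (Suc i) ` free_mod (?T (Suc (Suc i)))"
      then show "v \<in> {v \<in> free_mod (?T (Suc i)). boundary ?T ?d i v = (\<lambda>_. 0)}"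
        using sq boundary_mem[of ?T ?d "Suc i"] by auto
    qed
  qed
qed


section \<open>The Morse resolution of a matching on the Taylor complex\<close>

text \<open>
  A path in an acyclic graph repeats no vertex.
\<close>

lemma finite_graph_paths:
  assumes "finite E" "acyclic E"
  shows "finite (graph_paths E u v)"
proof (rule finite_subset)
  show "finite {ps. set ps \<subseteq> insert u (Range E) \<and> distinct ps}"
    by (rule finite_subset_distinct) (simp add: assms finite_Range)
  have "set ps \<subseteq> insert (hd ps) (Range E)" if "successively (\<lambda>a b. (a, b) \<in> E) ps" for ps
    using that by (induction ps rule: induct_list012) auto
  moreover have "distinct ps" if "successively (\<lambda>a b. (a, b) \<in> E) ps" for ps
  proof -
    have "successively (\<lambda>a b. (a, b) \<in> E\<^sup>+) ps"
      using that by (rule successively_mono) auto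
    then have "sorted_wrt (\<lambda>a b. (a, b) \<in> E\<^sup>+) ps"
      by (subst (asm) successively_conv_sorted_wrt) (auto intro: transpI)
    then show ?thesis
      using assms(2) by (induction ps) (auto simp: acyclic_def)
  qed
  ultimately show "graph_paths E u v \<subseteq> {ps. set ps \<subseteq> insert u (Range E) \<and> distinct ps}"
    by (auto simp: graph_paths_def)
qed

lemma graph_paths_first_step:
  "graph_paths E u v = (if u = v then {[u]} else {}) \<union> (\<Union>w\<in>{w. (u, w) \<in> E}. (#) u ` graph_paths E w v)"
proof (intro equalityI subsetI)
  fix ps assume ps: "ps \<in> graph_paths E u v"
  show "ps \<in> (if u = v then {[u]} else {}) \<union> (\<Union>w\<in>{w. (u, w) \<in> E}. (#) u ` graph_paths E w v)"
  proof (cases ps rule: remdups_adj.cases)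
    case (3 x y xs)
    then have "y # xs \<in> graph_paths E y v" "(u, y) \<in> E" "ps = u # y # xs"
      using ps by (auto simp: graph_paths_def)
    then show ?thesis by blast
  qed (use ps in \<open>auto simp: graph_paths_def\<close>)
next
  fix ps assume "ps \<in> (if u = v then {[u]} else {}) \<union> (\<Union>w\<in>{w. (u, w) \<in> E}. (#) u ` graph_paths E w v)"
  then show "ps \<in> graph_paths E u v"
    by (auto simp: graph_paths_def successively_Cons split: if_splits)
qed

lemma path_weight_Cons:
  assumes "ps \<in> graph_paths E w v"
  shows "path_weight r (u # ps) = edge_weight r u w * path_weight r ps"
  using assms by (cases ps) (auto simp: graph_paths_def)

lemma morse_diff_first_step:
  fixes G :: "('n::finite) mono set"
  assumes fin: "finite (reversed_graph G A)" and acyc: "acyclic (reversed_graph G A)"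
  shows "(morse_diff r G A \<sigma> \<tau> :: ('n, 'k::field) polys) = (if \<sigma> = \<tau> then 1 else 0) +
     (\<Sum>\<rho> | (\<sigma>, \<rho>) \<in> reversed_graph G A. edge_weight r \<sigma> \<rho> * morse_diff r G A \<rho> \<tau>)"
proof -
  let ?E = "reversed_graph G A"
  let ?P = "\<lambda>\<rho>. (#) \<sigma> ` graph_paths ?E \<rho> \<tau>"
  have fin_succ: "finite {\<rho>. (\<sigma>, \<rho>) \<in> ?E}"
    by (rule finite_subset[OF _ finite_Range[OF fin]]) auto
  have fin_P: "finite (?P \<rho>)" for \<rho> using finite_graph_paths[OF fin acyc] by blast
  have "(morse_diff r G A \<sigma> \<tau> :: ('n, 'k) polys)
      = (\<Sum>ps\<in>(if \<sigma> = \<tau> then {[\<sigma>]} else {}). path_weight r ps)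
        + (\<Sum>ps\<in>(\<Union>\<rho>\<in>{\<rho>. (\<sigma>, \<rho>) \<in> ?E}. ?P \<rho>). path_weight r ps)"
    unfolding morse_diff_def graph_paths_first_step[of ?E \<sigma>]
    using fin_succ fin_P by (intro sum.union_disjoint) (auto simp: graph_paths_def)
  also have "(\<Sum>ps\<in>(\<Union>\<rho>\<in>{\<rho>. (\<sigma>, \<rho>) \<in> ?E}. ?P \<rho>). path_weight r ps :: ('n, 'k) polys)
      = (\<Sum>\<rho> | (\<sigma>, \<rho>) \<in> ?E. \<Sum>ps\<in>?P \<rho>. path_weight r ps)"
    using fin_succ fin_P by (intro sum.UNION_disjoint) (auto simp: graph_paths_def)
  also have "\<dots> = (\<Sum>\<rho> | (\<sigma>, \<rho>) \<in> ?E. edge_weight r \<sigma> \<rho> * morse_diff r G A \<rho> \<tau>)"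
  proof (rule sum.cong[OF refl])
    fix \<rho>
    have "(\<Sum>ps\<in>?P \<rho>. path_weight r ps :: ('n, 'k) polys)
        = (\<Sum>ps\<in>graph_paths ?E \<rho> \<tau>. path_weight r (\<sigma> # ps))"
      by (subst sum.reindex) (auto simp: inj_on_def)
    also have "\<dots> = edge_weight r \<sigma> \<rho> * morse_diff r G A \<rho> \<tau>"
      unfolding morse_diff_def sum_distrib_left by (rule sum.cong) (auto simp: path_weight_Cons)
    finally show "(\<Sum>ps\<in>?P \<rho>. path_weight r ps :: ('n, 'k) polys)
        = edge_weight r \<sigma> \<rho> * morse_diff r G A \<rho> \<tau>" .
  qed
  finally show ?thesis by auto
qed

lemma finite_reversed_graph:
  assumes "finite G" "A \<subseteq> taylor_edges G"
  shows "finite (reversed_graph G A)"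
  by (rule finite_subset[of _ "Pow G \<times> Pow G"])
    (use assms in \<open>auto simp: reversed_graph_def taylor_edges_def\<close>)

text \<open>
  The theorem of Batzies and Welker for the Taylor resolution. Only matchings that preserve lcms make
  the coefficients of matched pairs units.
\<close>

theorem taylor_morse_resolution:
  fixes I :: "('n::finite, 'k::field) polys set"
  assumes r: "linear_order_on G r" and G: "finite G"
    and A: "homogeneous_acyclic_matching G mono_lcm A" and "{} \<in> critical G A"
    and I: "I = {p. \<forall>\<mu>\<in>Poly_Mapping.keys p. \<exists>g\<in>G. mono_dvd g \<mu>}"
  shows "free_resolution_of_quotient I (morse_basis G A) (morse_diff r G A) (\<lambda>_. 1)"
proof -
  have A_edges: "A \<subseteq> taylor_edges G" and A_acyc: "acyclic (reversed_graph G A)"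
    using A by (auto simp: homogeneous_acyclic_matching_def)
  interpret morse_matching G A "taylor_matrix r G :: _ \<Rightarrow> _ \<Rightarrow> ('n, 'k) polys"
    "morse_diff r G A :: _ \<Rightarrow> _ \<Rightarrow> ('n, 'k) polys"
  proof
    show "finite G" by (rule G)
    show "A \<subseteq> taylor_edges G" by (rule A_edges)
    show "acyclic (reversed_graph G A)" by (rule A_acyc)
    show "{\<sigma>, \<tau>} \<inter> {\<sigma>', \<tau>'} = {}"
      if "(\<sigma>, \<tau>) \<in> A" "(\<sigma>', \<tau>') \<in> A" "(\<sigma>, \<tau>) \<noteq> (\<sigma>', \<tau>')" for \<sigma> \<tau> \<sigma>' \<tau>'
    proof -
      have "\<forall>(\<sigma>, \<tau>)\<in>A. \<forall>(\<sigma>', \<tau>')\<in>A. (\<sigma>, \<tau>) \<noteq> (\<sigma>', \<tau>') \<longrightarrow> {\<sigma>, \<tau>} \<inter> {\<sigma>', \<tau>'} = {}"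
        using A by (simp add: homogeneous_acyclic_matching_def)
      from bspec[OF bspec[OF this that(1), unfolded prod.case] that(2), unfolded prod.case] that(3)
      show ?thesis by blast
    qed
    show "taylor_matrix r G \<sigma> \<tau> * taylor_matrix r G \<sigma> \<tau> = (1 :: ('n, 'k) polys)" if e: "(\<sigma>, \<tau>) \<in> A" for \<sigma> \<tau>
    proof -
      have "mono_lcm \<sigma> = mono_lcm \<tau>"
        using A that by (auto simp: homogeneous_acyclic_matching_def)
      moreover obtain m where m: "m \<in> G - \<tau>" "\<tau> \<subseteq> G" "\<sigma> = insert m \<tau>"
        using iffD1[OF taylor_edge_insert[OF G] subsetD[OF A_edges e]] by blast
      ultimately have "taylor_matrix r G \<sigma> \<tau> = (taylor_sign r \<sigma> m :: ('n, 'k) polys)"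
        using taylor_matrix_insert[OF G m(1,2), of r, where 'k='k] by (simp add: monom_def)
      then show ?thesis by (simp add: taylor_sign_square)
    qed
    show "taylor_matrix r G \<sigma> \<tau> = (0 :: ('n, 'k) polys)" if "(\<sigma>, \<tau>) \<notin> taylor_edges G" for \<sigma> \<tau>
      using that by (simp add: taylor_matrix_def)
    show "(\<Sum>\<sigma>\<in>morse_basis G {} (Suc i). taylor_matrix r G \<upsilon> \<sigma> * taylor_matrix r G \<sigma> \<tau>)
        = (0 :: ('n, 'k) polys)"
      if "\<upsilon> \<in> morse_basis G {} (Suc (Suc i))" "\<tau> \<in> morse_basis G {} i" for \<upsilon> \<tau> i
      by (rule taylor_matrix_square[OF r G that])
    show "(morse_diff r G A \<sigma> \<tau> :: ('n, 'k) polys) = (if \<sigma> = \<tau> then 1 else 0) +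
       (\<Sum>\<rho> | (\<sigma>, \<rho>) \<in> reversed_graph G A.
         (if \<rho> \<subset> \<sigma> then taylor_matrix r G \<sigma> \<rho> else - taylor_matrix r G \<rho> \<sigma>) * morse_diff r G A \<rho> \<tau>)"
      for \<sigma> \<tau>
    proof -
      have "(edge_weight r \<sigma> \<rho> :: ('n, 'k) polys)
          = (if \<rho> \<subset> \<sigma> then taylor_matrix r G \<sigma> \<rho> else - taylor_matrix r G \<rho> \<sigma>)"
        if "(\<sigma>, \<rho>) \<in> reversed_graph G A" for \<rho>
        using that A_edges taylor_edgesD(2)[of \<rho> \<sigma> G] taylor_edgesD(2)[of \<sigma> \<rho> G]
        by (auto simp: edge_weight_def taylor_matrix_def reversed_graph_def)
      then show ?thesis
        by (subst morse_diff_first_step[OF finite_reversed_graph[OF G A_edges] A_acyc]) simp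
    qed
  qed
  show ?thesis
    by (rule morse_resolution[OF taylor_resolution[OF r G I] assms(4)])
qed

lemma module_times: "module ((*) :: 'a::comm_ring_1 \<Rightarrow> 'a \<Rightarrow> 'a)"
  by standard (auto simp: algebra_simps)

lemma monom_mem_irrelevant_ideal:
  fixes m :: "'n mono"
  assumes "m \<noteq> 0"
  shows "monom m \<in> (irrelevant_ideal :: ('n, 'k::field) polys set)"
proof -
  interpret module "(*) :: ('n, 'k) polys \<Rightarrow> _" by (rule module_times)
  obtain i where i: "lookup m i \<noteq> 0" using assms by (auto simp: poly_mapping_eq_iff fun_eq_iff)
  have "(m - Poly_Mapping.single i 1) + Poly_Mapping.single i 1 = m"
    using i by (intro poly_mapping_eqI) (auto simp: lookup_add lookup_minus lookup_single when_def)
  then have "monom m = monom (m - Poly_Mapping.single i 1) * (monom (Poly_Mapping.single i 1) :: ('n, 'k) polys)"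
    by (simp add: monom_add[symmetric])
  moreover have "\<dots> \<in> irrelevant_ideal"
    unfolding irrelevant_ideal_def by (intro span_scale span_base) simp
  ultimately show ?thesis by simp
qed

lemma irrelevant_ideal_mult:
  "p \<in> irrelevant_ideal \<Longrightarrow> q * p \<in> irrelevant_ideal"
  unfolding irrelevant_ideal_def by (rule module.span_scale[OF module_times])

lemma irrelevant_ideal_sum:
  "(\<And>x. x \<in> X \<Longrightarrow> F x \<in> irrelevant_ideal) \<Longrightarrow> sum F X \<in> irrelevant_ideal"
  unfolding irrelevant_ideal_def by (rule module.span_sum[OF module_times])

text \<open>
  If the lcm changes along a path, it changes along one of the edges; this edge is not a matching
  edge, and its coefficient is a multiple of a monomial other than \<open>1\<close>.
\<close>

lemma path_weight_irrelevant:
  fixes G :: "('n::finite) mono set"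
  assumes G: "finite G" and A: "homogeneous_acyclic_matching G mono_lcm A"
    and "ps \<in> graph_paths (reversed_graph G A) \<sigma> \<tau>" "mono_lcm \<sigma> \<noteq> mono_lcm \<tau>"
  shows "path_weight r ps \<in> (irrelevant_ideal :: ('n, 'k::field) polys set)"
  using assms(3,4)
proof (induction ps arbitrary: \<sigma>)
  case Nil
  then show ?case by (simp add: graph_paths_def)
next
  case (Cons a ps)
  have "[\<sigma>] \<notin> graph_paths (reversed_graph G A) \<sigma> \<tau>"
    using Cons.prems by (auto simp: graph_paths_def)
  then obtain \<rho> where \<rho>: "a = \<sigma>" "(\<sigma>, \<rho>) \<in> reversed_graph G A" "ps \<in> graph_paths (reversed_graph G A) \<rho> \<tau>"
    using Cons.prems(1) graph_paths_first_step[of "reversed_graph G A" \<sigma> \<tau>] by (auto split: if_splits)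
  have weight: "path_weight r (a # ps) = edge_weight r \<sigma> \<rho> * (path_weight r ps :: ('n, 'k) polys)"
    using path_weight_Cons[OF \<rho>(3)] \<rho>(1) by simp
  show ?case
  proof (cases "mono_lcm \<sigma> = mono_lcm \<rho>")
    case True
    then show ?thesis
      unfolding weight using Cons.IH[OF \<rho>(3)] Cons.prems(2) by (auto intro: irrelevant_ideal_mult)
  next
    case False
    then have "(\<rho>, \<sigma>) \<notin> A" using A by (auto simp: homogeneous_acyclic_matching_def)
    then have e: "(\<sigma>, \<rho>) \<in> taylor_edges G" using \<rho>(2) by (auto simp: reversed_graph_def)
    have "finite \<sigma>" using taylor_edgesD(1)[OF e] G finite_subset by blast
    then have "mono_dvd (mono_lcm \<rho>) (mono_lcm \<sigma>)"
      using taylor_edgesD(2)[OF e] by (intro mono_lcm_mono) auto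
    then have "mono_lcm \<sigma> - mono_lcm \<rho> \<noteq> 0"
      using False mono_dvd_add_diff by fastforce
    then have "(taylor_coeff r \<sigma> \<rho> :: ('n, 'k) polys) \<in> irrelevant_ideal"
      unfolding taylor_coeff_def by (intro irrelevant_ideal_mult monom_mem_irrelevant_ideal)
    then show ?thesis
      unfolding weight edge_weight_def using taylor_edgesD(2)[OF e]
      by (auto simp: mult.commute[of "taylor_coeff _ _ _"] intro: irrelevant_ideal_mult)
  qed
qed

theorem taylor_morse_minimal:
  fixes G :: "('n::finite) mono set"
  assumes G: "finite G" and A: "homogeneous_acyclic_matching G mono_lcm A"
    and inj: "inj_on mono_lcm (critical G A)"
  shows "minimal_complex (morse_basis G A) (morse_diff r G A :: _ \<Rightarrow> _ \<Rightarrow> ('n, 'k::field) polys)"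
  unfolding minimal_complex_def
proof (intro allI ballI)
  fix i v \<tau>
  assume \<tau>: "\<tau> \<in> morse_basis G A i"
  have "(morse_diff r G A \<sigma> \<tau> :: ('n, 'k) polys) \<in> irrelevant_ideal" if "\<sigma> \<in> morse_basis G A (Suc i)" for \<sigma>
  proof -
    have "mono_lcm \<sigma> \<noteq> mono_lcm \<tau>"
      using inj_onD[OF inj] \<tau> that by (fastforce simp: morse_basis_def)
    then show ?thesis
      unfolding morse_diff_def by (intro irrelevant_ideal_sum path_weight_irrelevant[OF G A])
  qed
  then show "boundary (morse_basis G A) (morse_diff r G A) i v \<tau> \<in> (irrelevant_ideal :: ('n, 'k) polys set)"
    using \<tau> by (auto simp: boundary_def intro!: irrelevant_ideal_sum irrelevant_ideal_mult)
qed


section \<open>Minimal generators of monomial ideals\<close>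

text \<open>
  Choose successive indices \<open>x\<close> at which \<open>g\<close> is minimal among all later values.
\<close>

lemma nondecreasing_subsequence:
  fixes g :: "nat \<Rightarrow> nat"
  obtains s :: "nat \<Rightarrow> nat" where "strict_mono s" "mono (g \<circ> s)"
proof -
  have ex: "\<exists>x\<ge>n. \<forall>k\<ge>x. g x \<le> g k" for n
  proof -
    obtain x where "x \<ge> n" "\<forall>k. k \<ge> n \<longrightarrow> g x \<le> g k"
      using ex_has_least_nat[of "\<lambda>k. k \<ge> n" n g] by auto
    then show ?thesis by (meson order_trans)
  qed
  obtain s where s: "\<And>n. \<forall>k\<ge>s n. g (s n) \<le> g k" "\<And>n. s n < s (Suc n)"
    using dependent_nat_choice[of "\<lambda>_ x. \<forall>k\<ge>x. g x \<le> g k" "\<lambda>_ x y. x < y"] ex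
    by (metis Suc_le_eq)
  have "strict_mono s" using s(2) by (simp add: strict_mono_Suc_iff)
  moreover have "mono (g \<circ> s)"
    using s by (auto simp: mono_iff_le_Suc less_imp_le)
  ultimately show ?thesis using that by blast
qed

lemma dickson_sequence:
  fixes f :: "nat \<Rightarrow> 'n mono"
  assumes "finite J"
  shows "\<exists>s :: nat \<Rightarrow> nat. strict_mono s \<and> (\<forall>j\<in>J. mono (\<lambda>n. lookup (f (s n)) j))"
  using assms
proof (induction J)
  case empty
  show ?case by (auto intro: strict_mono_id)
next
  case (insert j J)
  then obtain s :: "nat \<Rightarrow> nat" where s: "strict_mono s" "\<And>i. i \<in> J \<Longrightarrow> mono (\<lambda>n. lookup (f (s n)) i)" by blast
  obtain t :: "nat \<Rightarrow> nat" where t: "strict_mono t" "mono ((\<lambda>n. lookup (f (s n)) j) \<circ> t)"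
    by (rule nondecreasing_subsequence)
  have "strict_mono (s \<circ> t)" using s(1) t(1) by (rule strict_mono_o)
  moreover have "mono (\<lambda>n. lookup (f ((s \<circ> t) n)) i)" if "i \<in> insert j J" for i
  proof (cases "i = j")
    case True
    then show ?thesis using t(2) by (simp add: comp_def)
  next
    case False
    then have "mono (\<lambda>n. lookup (f (s n)) i)" using that s(2) by simp
    then show ?thesis using strict_mono_mono[OF t(1)] by (simp add: mono_def)
  qed
  ultimately show ?case by blast
qed

text \<open>
  Dickson's lemma. A sequence of distinct elements would have a subsequence that is nondecreasing in
  every one of the finitely many coordinates, and its first two terms would be comparable.
\<close>

theorem dickson:
  fixes S :: "('n::finite) mono set"
  assumes "\<And>a b. a \<in> S \<Longrightarrow> b \<in> S \<Longrightarrow> mono_dvd a b \<Longrightarrow> a = b"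
  shows "finite S"
proof (rule ccontr)
  assume "infinite S"
  then obtain f :: "nat \<Rightarrow> 'n mono" where f: "inj f" "range f \<subseteq> S"
    using infinite_countable_subset by blast
  obtain s :: "nat \<Rightarrow> nat" where s: "strict_mono s" "\<And>j. mono (\<lambda>n. lookup (f (s n)) j)"
    using dickson_sequence[of UNIV f] by auto
  have "mono_dvd (f (s 0)) (f (s 1))"
    using s(2) by (auto simp: mono_dvd_def mono_def)
  then have "f (s 0) = f (s 1)" using assms f(2) by blast
  then have "s 0 = s 1" using f(1) by (simp add: inj_eq)
  then show False using s(1) by (simp add: strict_mono_eq)
qed

definition total_degree :: "('n::finite) mono \<Rightarrow> nat" where
  "total_degree m = (\<Sum>i\<in>UNIV. lookup m i)"

lemma total_degree_less:
  assumes "mono_dvd a b" "a \<noteq> b"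
  shows "total_degree a < total_degree b"
proof -
  obtain i where "lookup a i \<noteq> lookup b i" using assms(2) by (auto intro: poly_mapping_eqI)
  then have "lookup a i < lookup b i" using assms(1) by (simp add: mono_dvd_def order.not_eq_order_implies_strict)
  then show ?thesis
    unfolding total_degree_def using assms(1) by (intro sum_strict_mono_ex1) (auto simp: mono_dvd_def)
qed

lemma min_gens_antichain: "\<forall>a\<in>min_gens I. \<forall>b\<in>min_gens I. mono_dvd a b \<longrightarrow> a = b"
  by (auto simp: min_gens_def)

lemma finite_min_gens: "finite (min_gens (I :: ('n::finite, 'k::field) polys set))"
  by (rule dickson) (use min_gens_antichain in blast)

lemma min_gens_divides:
  fixes I :: "('n::finite, 'k::field) polys set"
  assumes "monom m \<in> I"
  obtains g where "g \<in> min_gens I" "mono_dvd g m"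
proof -
  obtain g where g: "monom g \<in> I" "mono_dvd g m"
    "\<And>h. monom h \<in> I \<Longrightarrow> mono_dvd h m \<Longrightarrow> total_degree g \<le> total_degree h"
    using ex_has_least_nat[of "\<lambda>h. monom h \<in> I \<and> mono_dvd h m" m total_degree] assms mono_dvd_refl
    by blast
  have "h = g" if "monom h \<in> I" "mono_dvd h g" for h
    using total_degree_less[of h g] that g(3)[of h] mono_dvd_trans[OF that(2) g(2)] by force
  then have "g \<in> min_gens I" using g(1) by (auto simp: min_gens_def)
  then show ?thesis using g(2) that by blast
qed

text \<open>
  The polynomials all of whose monomials lie in \<open>I\<close> form a submodule containing the generating
  monomials of \<open>I\<close>, hence all of \<open>I\<close>.
\<close>

lemma monomial_ideal_iff_min_gens:
  fixes I :: "('n::finite, 'k::field) polys set"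
  assumes "monomial_ideal I"
  shows "I = {p. \<forall>\<mu>\<in>Poly_Mapping.keys p. \<exists>g\<in>min_gens I. mono_dvd g \<mu>}"
proof -
  interpret module "(*) :: ('n, 'k) polys \<Rightarrow> _" by standard (auto simp: algebra_simps)
  obtain M where M: "I = span (monom ` M)" using assms by (auto simp: monomial_ideal_def)
  have I_sub: "subspace I" unfolding M by (rule subspace_span)
  have dvd_mem: "monom \<mu> \<in> I" if "monom g \<in> I" "mono_dvd g \<mu>" for g \<mu>
  proof -
    have "monom \<mu> = monom (\<mu> - g) * (monom g :: ('n, 'k) polys)"
      using that(2) by (simp add: monom_add[symmetric] mono_dvd_diff_add)
    then show ?thesis using subspace_scale[OF I_sub that(1)] by simp
  qed
  let ?S = "{p :: ('n, 'k) polys. \<forall>\<mu>\<in>Poly_Mapping.keys p. monom \<mu> \<in> I}"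
  have "subspace ?S"
  proof (rule subspaceI)
    show "p + q \<in> ?S" if "p \<in> ?S" "q \<in> ?S" for p q
      using that Poly_Mapping.keys_add[of p q] by auto
    show "c * p \<in> ?S" if "p \<in> ?S" for c p
    proof -
      have "monom \<mu> \<in> I" if \<mu>: "\<mu> \<in> Poly_Mapping.keys (c * p)" for \<mu>
      proof -
        obtain a b where "\<mu> = a + b" "b \<in> Poly_Mapping.keys p"
          using \<mu> keys_mult[of c p] by auto
        then show ?thesis using \<open>p \<in> ?S\<close> dvd_mem[of b \<mu>] mono_dvd_add(2)[of b a] by auto
      qed
      then show ?thesis by simp
    qed
  qed simp
  moreover have "monom ` M \<subseteq> ?S" by (auto simp: M monom_def span_base)
  ultimately have "I \<subseteq> ?S" unfolding M by (rule span_minimal[rotated])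
  then have "I \<subseteq> {p. \<forall>\<mu>\<in>Poly_Mapping.keys p. \<exists>g\<in>min_gens I. mono_dvd g \<mu>}"
    using min_gens_divides by blast
  moreover have "p \<in> I" if p: "\<forall>\<mu>\<in>Poly_Mapping.keys p. \<exists>g\<in>min_gens I. mono_dvd g \<mu>" for p
  proof -
    have "Poly_Mapping.single \<mu> (lookup p \<mu>) \<in> I" if "\<mu> \<in> Poly_Mapping.keys p" for \<mu>
    proof -
      have "monom \<mu> \<in> I" using p that dvd_mem by (auto simp: min_gens_def)
      moreover have "Poly_Mapping.single \<mu> (lookup p \<mu>) = Poly_Mapping.single 0 (lookup p \<mu>) * monom \<mu>"
        by (simp add: monom_def mult_single)
      ultimately show ?thesis using subspace_scale[OF I_sub] by metis
    qed
    then show ?thesis by (subst poly_eq_sum_single) (rule subspace_sum[OF I_sub])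
  qed
  ultimately show ?thesis by blast
qed

lemma zero_notin_min_gens:
  fixes I :: "('n::finite, 'k::field) polys set"
  assumes "monomial_ideal I" "I \<noteq> UNIV"
  shows "0 \<notin> min_gens I"
proof
  assume "0 \<in> min_gens I"
  moreover have "mono_dvd 0 \<mu>" for \<mu> :: "'n mono" by (simp add: mono_dvd_def)
  ultimately have "I = UNIV"
    using monomial_ideal_iff_min_gens[OF assms(1)] by blast
  then show False using assms(2) by contradiction
qed


section \<open>Pivots and their matching\<close>

lemma lookup_mono_lcm_attained:
  assumes "finite \<sigma>" "lookup (mono_lcm \<sigma>) j > 0"
  obtains m where "m \<in> \<sigma>" "lookup m j = lookup (mono_lcm \<sigma>) j"
proof -
  have "lookup (mono_lcm \<sigma>) j \<in> insert 0 ((\<lambda>m. lookup m j) ` \<sigma>)"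
    unfolding lookup_mono_lcm using assms(1) by (intro Max_in) auto
  then show ?thesis using assms(2) that by auto
qed

text \<open>
  Toggling membership of a pivot is an involution without fixed points on the sets with lcm \<open>p\<close>.
\<close>

definition pivot :: "('n::finite) mono set \<Rightarrow> 'n mono \<Rightarrow> 'n mono \<Rightarrow> bool" where
  "pivot G p m \<longleftrightarrow> m \<in> G \<and>
     (\<forall>\<sigma>\<subseteq>G. mono_lcm \<sigma> = p \<longrightarrow> mono_lcm (insert m \<sigma>) = p \<and> mono_lcm (\<sigma> - {m}) = p)"

text \<open>
  In coordinates where \<open>p\<close> exceeds \<open>ord\<^sub>j(I)\<close> the exponent of \<open>p\<close> is attained by elements other than
  \<open>m\<close>. In the remaining coordinates any single generator reaches the exponent of \<open>p\<close>, so one other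
  element of \<open>\<sigma>\<close> is enough. It exists as \<open>\<sigma> = {m}\<close> would make \<open>p = m\<close> a generator.
\<close>

lemma strict_divisor_pivot:
  fixes I :: "('n::finite, 'k::field) polys set"
  assumes "m \<in> min_gens I" "mono_dvd m p" "p \<notin> min_gens I"
    and strict: "\<And>j. lookup p j > ord_ideal j I \<Longrightarrow> lookup m j < lookup p j"
  shows "pivot (min_gens I) p m"
  unfolding pivot_def
proof (intro conjI allI impI)
  show "m \<in> min_gens I" by fact
  fix \<sigma> assume \<sigma>: "\<sigma> \<subseteq> min_gens I" "mono_lcm \<sigma> = p"
  have fin: "finite \<sigma>" using \<sigma>(1) finite_min_gens finite_subset by blast
  have dvd: "mono_dvd x p" if "x \<in> \<sigma>" for x using dvd_mono_lcm[OF fin that] \<sigma>(2) by simp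
  show "mono_lcm (insert m \<sigma>) = p"
  proof (rule mono_dvd_antisym)
    show "mono_dvd (mono_lcm (insert m \<sigma>)) p"
      by (subst mono_lcm_dvd_iff) (use fin dvd assms(2) in auto)
    show "mono_dvd p (mono_lcm (insert m \<sigma>))"
      unfolding \<sigma>(2)[symmetric] by (rule mono_lcm_mono) (use fin in auto)
  qed
  show "mono_lcm (\<sigma> - {m}) = p"
  proof (rule mono_dvd_antisym)
    show "mono_dvd (mono_lcm (\<sigma> - {m})) p"
      by (subst mono_lcm_dvd_iff) (use fin dvd in auto)
    have "lookup p j \<le> lookup (mono_lcm (\<sigma> - {m})) j" for j
    proof (cases "lookup p j > ord_ideal j I")
      case True
      then obtain x where x: "x \<in> \<sigma>" "lookup x j = lookup p j"
        using lookup_mono_lcm_attained[OF fin, of j] \<sigma>(2) by auto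
      then have "x \<in> \<sigma> - {m}" using strict[OF True] by auto
      then show ?thesis unfolding x(2)[symmetric]
        using dvd_mono_lcm[of "\<sigma> - {m}" x] fin by (simp add: mono_dvd_def)
    next
      case False
      show ?thesis
      proof (cases "\<sigma> - {m} = {}")
        case True
        have "\<sigma> \<noteq> {m}"
        proof
          assume "\<sigma> = {m}"
          then have "m = p" using \<sigma>(2) by (intro poly_mapping_eqI) (auto simp: lookup_mono_lcm)
          then show False using assms by simp
        qed
        then have "\<sigma> - {m} = \<sigma>" using True by auto
        then show ?thesis using \<sigma>(2) by simp
      next
        case nonempty: False
        then obtain x where x: "x \<in> \<sigma> - {m}" by blast
        have "lookup p j \<le> ord_ideal j I" using False by simp
        also have "\<dots> \<le> lookup x j"
          unfolding ord_ideal_def using x \<sigma>(1) by (intro Min_le finite_imageI finite_min_gens) auto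
        also have "\<dots> \<le> lookup (mono_lcm (\<sigma> - {m})) j"
          using dvd_mono_lcm[OF _ x] fin by (auto simp: mono_dvd_def)
        finally show ?thesis .
      qed
    qed
    then show "mono_dvd p (mono_lcm (\<sigma> - {m}))" by (simp add: mono_dvd_def)
  qed
qed

lemma mono_lcm_singleton: "mono_lcm {m} = m"
  by (rule poly_mapping_eqI) (simp add: lookup_mono_lcm)

text \<open>
  Every element of a set with lcm \<open>p \<in> G\<close> divides \<open>p\<close>, hence is \<open>p\<close>.
\<close>

lemma generator_not_shared_lcm:
  assumes "finite G" "0 \<notin> G" and anti: "\<forall>a\<in>G. \<forall>b\<in>G. mono_dvd a b \<longrightarrow> a = b"
    and "\<sigma> \<subseteq> G" "mono_lcm \<sigma> = p" "p \<in> G"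
  shows "\<sigma> = {p}"
proof -
  have "finite \<sigma>" using assms finite_subset by blast
  then have "x = p" if "x \<in> \<sigma>" for x
    using dvd_mono_lcm[OF _ that] anti assms that by blast
  moreover have "\<sigma> \<noteq> {}"
  proof
    assume "\<sigma> = {}"
    then have "p = 0" using assms(5) by (simp add: mono_lcm_empty)
    then show False using assms(2,6) by simp
  qed
  ultimately show ?thesis by blast
qed

text \<open>
  The third generator from the genericity condition divides the lcm of \<open>a\<close> and \<open>b\<close>, hence \<open>p\<close>. It is
  a strict divisor of \<open>p\<close> also in coordinates where \<open>a\<close> and \<open>b\<close> only have the exponent \<open>ord\<^sub>j(I)\<close>
  but \<open>p\<close> has a larger one, since there it cannot exceed that exponent.
\<close>

lemma generic_pivot:
  fixes I :: "('n::finite, 'k::field) polys set"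
  assumes gen: "generic_ideal I" and zero: "0 \<notin> min_gens I"
    and \<sigma>: "\<sigma> \<subseteq> min_gens I" "mono_lcm \<sigma> = p" and \<tau>: "\<tau> \<subseteq> min_gens I" "mono_lcm \<tau> = p"
    and "\<sigma> \<noteq> \<tau>"
  shows "\<exists>m. pivot (min_gens I) p m"
proof -
  let ?G = "min_gens I"
  have p: "p \<notin> ?G"
    using generator_not_shared_lcm[OF finite_min_gens zero min_gens_antichain \<sigma>]
      generator_not_shared_lcm[OF finite_min_gens zero min_gens_antichain \<tau>] \<open>\<sigma> \<noteq> \<tau>\<close> by blast
  define \<upsilon> where "\<upsilon> = \<sigma> \<union> \<tau>"
  have \<upsilon>: "\<upsilon> \<subseteq> ?G" "finite \<upsilon>" using \<sigma> \<tau> finite_subset[OF _ finite_min_gens, of _ I] by (auto simp: \<upsilon>_def)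
  have dvd: "mono_dvd x p" if "x \<in> \<upsilon>" for x
    using that \<upsilon> dvd_mono_lcm[of \<sigma> x] dvd_mono_lcm[of \<tau> x] \<sigma> \<tau> by (auto simp: \<upsilon>_def)
  \<comment> \<open>deleting an element in which \<open>\<sigma>\<close> and \<open>\<tau>\<close> differ keeps one of the two sets inside \<open>\<upsilon>\<close>\<close>
  obtain a where a: "a \<in> \<upsilon>" "\<sigma> \<subseteq> \<upsilon> - {a} \<or> \<tau> \<subseteq> \<upsilon> - {a}"
    using \<open>\<sigma> \<noteq> \<tau>\<close> unfolding \<upsilon>_def by blast
  have lcm_a: "mono_lcm (\<upsilon> - {a}) = p"
  proof (rule mono_dvd_antisym)
    show "mono_dvd (mono_lcm (\<upsilon> - {a})) p"
      by (subst mono_lcm_dvd_iff) (use \<upsilon> dvd in auto)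
    show "mono_dvd p (mono_lcm (\<upsilon> - {a}))"
      using a(2) mono_lcm_mono[of "\<upsilon> - {a}" \<sigma>] mono_lcm_mono[of "\<upsilon> - {a}" \<tau>] \<upsilon>(2) \<sigma>(2) \<tau>(2)
      by (metis finite_Diff)
  qed
  show ?thesis
  proof (cases "\<forall>j. lookup p j > ord_ideal j I \<longrightarrow> lookup a j < lookup p j")
    case True
    then show ?thesis using strict_divisor_pivot[of a I p] a(1) \<upsilon>(1) dvd p by blast
  next
    case False
    then obtain j where j: "lookup p j > ord_ideal j I" "\<not> lookup a j < lookup p j" by blast
    then have aj: "lookup a j = lookup p j" using dvd[OF a(1)] by (simp add: mono_dvd_def order_antisym)
    obtain b where b: "b \<in> \<upsilon> - {a}" "lookup b j = lookup p j"
      using lookup_mono_lcm_attained[of "\<upsilon> - {a}" j] lcm_a j(1) \<upsilon>(2) by auto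
    have "\<exists>i. lookup a i = lookup b i \<and> lookup a i > ord_ideal i I" using aj b(2) j(1) by (intro exI[of _ j]) simp
    moreover have "a \<in> ?G" "b \<in> ?G" "a \<noteq> b" using a b \<upsilon>(1) by auto
    ultimately obtain c where c: "c \<in> ?G" "mono_dvd c (mono_lcm {a, b})"
      "\<And>i. max (lookup a i) (lookup b i) > lookup c i \<longleftrightarrow> max (lookup a i) (lookup b i) > ord_ideal i I"
      using gen unfolding generic_ideal_def by meson
    have ab: "lookup a i \<le> lookup p i" "lookup b i \<le> lookup p i" for i
      using dvd a(1) b(1) by (auto simp: mono_dvd_def)
    have ci: "lookup c i \<le> max (lookup a i) (lookup b i)" for i
      using c(2) by (simp add: mono_dvd_def lookup_mono_lcm)
    have "pivot ?G p c"
    proof (rule strict_divisor_pivot[OF c(1) _ p])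
      show "mono_dvd c p" unfolding mono_dvd_def using ab ci by (meson max.bounded_iff order_trans)
      show "lookup c i < lookup p i" if "lookup p i > ord_ideal i I" for i
      proof (cases "max (lookup a i) (lookup b i) > ord_ideal i I")
        case True
        then show ?thesis using c(3)[of i] ab[of i] by linarith
      next
        case False
        then show ?thesis using that ci[of i] by linarith
      qed
    qed
    then show ?thesis by blast
  qed
qed

definition pivot_elem :: "('n::finite) mono set \<Rightarrow> 'n mono \<Rightarrow> 'n mono" where
  "pivot_elem G p = (SOME m. pivot G p m)"

definition pivot_matching :: "('n::finite) mono set \<Rightarrow> ('n mono set \<times> 'n mono set) set" where
  "pivot_matching G = {(\<sigma>, \<tau>). \<sigma> \<subseteq> G \<and> (\<exists>m. pivot G (mono_lcm \<sigma>) m) \<and>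
     pivot_elem G (mono_lcm \<sigma>) \<in> \<sigma> \<and> \<tau> = \<sigma> - {pivot_elem G (mono_lcm \<sigma>)}}"

lemma pivot_elem: "pivot G p m \<Longrightarrow> pivot G p (pivot_elem G p)"
  unfolding pivot_elem_def by (rule someI)

lemma pivot_matching_lcm:
  assumes "(\<sigma>, \<tau>) \<in> pivot_matching G"
  shows "mono_lcm \<tau> = mono_lcm \<sigma>"
proof -
  have "\<sigma> \<subseteq> G" "\<tau> = \<sigma> - {pivot_elem G (mono_lcm \<sigma>)}" "pivot G (mono_lcm \<sigma>) (pivot_elem G (mono_lcm \<sigma>))"
    using assms pivot_elem by (auto simp: pivot_matching_def)
  then show ?thesis by (simp add: pivot_def)
qed

lemma pivot_matching_edges:
  assumes "finite G"
  shows "pivot_matching G \<subseteq> taylor_edges G"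
proof
  fix e assume "e \<in> pivot_matching G"
  then obtain \<sigma> m where "e = (\<sigma>, \<sigma> - {m})" "m \<in> \<sigma>" "\<sigma> \<subseteq> G" by (auto simp: pivot_matching_def)
  moreover from this have "finite \<sigma>" using assms finite_subset by blast
  ultimately show "e \<in> taylor_edges G"
    using card_Suc_Diff1[of \<sigma> m] by (auto simp: taylor_edges_def)
qed

text \<open>
  Along every edge the triple formed by the degree of the lcm, the absence of the pivot and the
  cardinality decreases lexicographically. A reversed edge adds the pivot. An edge that removes the
  pivot and keeps the lcm belongs to the matching, so it is not available downwards.
\<close>

lemma acyclic_pivot_matching:
  assumes G: "finite G"
  shows "acyclic (reversed_graph G (pivot_matching G))"
proof -
  \<comment> \<open>constant on the sets whose lcm has no pivot, as \<open>pivot_elem\<close> is arbitrary there\<close>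
  define low where "low = (\<lambda>\<sigma>. if (\<exists>m. pivot G (mono_lcm \<sigma>) m) \<and> pivot_elem G (mono_lcm \<sigma>) \<notin> \<sigma> then 1 else 0 :: nat)"
  let ?M = "measures [\<lambda>\<sigma>. total_degree (mono_lcm \<sigma>), low, card]"
  have "(\<tau>, \<sigma>) \<in> ?M" if "(\<sigma>, \<tau>) \<in> reversed_graph G (pivot_matching G)" for \<sigma> \<tau>
  proof (cases "(\<tau>, \<sigma>) \<in> pivot_matching G")
    case True
    then have "mono_lcm \<tau> = mono_lcm \<sigma>" "low \<tau> = 0" "low \<sigma> = 1"
      using pivot_matching_lcm[OF True] by (auto simp: low_def pivot_matching_def)
    then show ?thesis by simp
  next
    case False
    then have e: "(\<sigma>, \<tau>) \<in> taylor_edges G" "(\<sigma>, \<tau>) \<notin> pivot_matching G"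
      using that by (auto simp: reversed_graph_def)
    obtain x where x: "x \<in> G - \<tau>" "\<tau> \<subseteq> G" "\<sigma> = insert x \<tau>"
      using iffD1[OF taylor_edge_insert[OF G] e(1)] by blast
    have fin: "finite \<sigma>" using taylor_edgesD(1)[OF e(1)] G finite_subset by blast
    have "mono_dvd (mono_lcm \<tau>) (mono_lcm \<sigma>)"
      using x(3) fin by (intro mono_lcm_mono) auto
    moreover have "low \<tau> \<le> low \<sigma>" if eq: "mono_lcm \<tau> = mono_lcm \<sigma>"
    proof (rule ccontr)
      assume "\<not> low \<tau> \<le> low \<sigma>"
      then have "\<exists>m. pivot G (mono_lcm \<sigma>) m" "pivot_elem G (mono_lcm \<sigma>) \<notin> \<tau>" "pivot_elem G (mono_lcm \<sigma>) \<in> \<sigma>"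
        using eq by (auto simp: low_def split: if_splits)
      moreover from this have "x = pivot_elem G (mono_lcm \<sigma>)" using x(3) by (metis insertE)
      then have "\<tau> = \<sigma> - {pivot_elem G (mono_lcm \<sigma>)}" using x(1,3) by blast
      ultimately have "(\<sigma>, \<tau>) \<in> pivot_matching G"
        using taylor_edgesD(1)[OF e(1)] unfolding pivot_matching_def by simp
      then show False using e(2) by blast
    qed
    moreover have "card \<tau> < card \<sigma>" using taylor_edgesD(4)[OF e(1)] by simp
    ultimately show ?thesis
      using total_degree_less[of "mono_lcm \<tau>" "mono_lcm \<sigma>"]
      by (cases "mono_lcm \<tau> = mono_lcm \<sigma>") (auto simp: le_less)
  qed
  then have "(reversed_graph G (pivot_matching G))\<inverse> \<subseteq> ?M" by auto
  then have "wf ((reversed_graph G (pivot_matching G))\<inverse>)" by (rule wf_subset[rotated]) simp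
  then show ?thesis using wf_acyclic acyclic_converse by blast
qed

lemma pivot_matching_homogeneous_acyclic:
  assumes G: "finite G" and f: "\<And>\<sigma> \<tau>. mono_lcm \<sigma> = mono_lcm \<tau> \<Longrightarrow> f \<sigma> = f \<tau>"
  shows "homogeneous_acyclic_matching G f (pivot_matching G)"
proof -
  have "{\<sigma>, \<tau>} \<inter> {\<sigma>', \<tau>'} = {}"
    if e: "(\<sigma>, \<tau>) \<in> pivot_matching G" "(\<sigma>', \<tau>') \<in> pivot_matching G" and ne: "(\<sigma>, \<tau>) \<noteq> (\<sigma>', \<tau>')"
    for \<sigma> \<tau> \<sigma>' \<tau>'
  proof (rule ccontr)
    assume meet: "{\<sigma>, \<tau>} \<inter> {\<sigma>', \<tau>'} \<noteq> {}"
    then have lcm: "mono_lcm \<sigma> = mono_lcm \<sigma>'"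
      using pivot_matching_lcm[OF e(1)] pivot_matching_lcm[OF e(2)] by auto
    define m where "m = pivot_elem G (mono_lcm \<sigma>)"
    have "m \<in> \<sigma>" "\<tau> = \<sigma> - {m}" "m \<in> \<sigma>'" "\<tau>' = \<sigma>' - {m}"
      using e lcm by (auto simp: pivot_matching_def m_def)
    then show False using meet ne by auto
  qed
  moreover have "f \<sigma> = f \<tau>" if "(\<sigma>, \<tau>) \<in> pivot_matching G" for \<sigma> \<tau>
    by (rule f) (rule pivot_matching_lcm[OF that, symmetric])
  ultimately show ?thesis
    unfolding homogeneous_acyclic_matching_def
    using pivot_matching_edges[OF G] acyclic_pivot_matching[OF G] by blast
qed

lemma critical_not_pivotal:
  assumes "\<sigma> \<in> critical G (pivot_matching G)"
  shows "\<nexists>m. pivot G (mono_lcm \<sigma>) m"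
proof
  assume ex: "\<exists>m. pivot G (mono_lcm \<sigma>) m"
  define m where "m = pivot_elem G (mono_lcm \<sigma>)"
  have \<sigma>: "\<sigma> \<subseteq> G" "\<And>e. e \<in> pivot_matching G \<Longrightarrow> \<sigma> \<noteq> fst e \<and> \<sigma> \<noteq> snd e"
    using assms by (auto simp: critical_def)
  have m: "m \<in> G" "mono_lcm (insert m \<sigma>) = mono_lcm \<sigma>"
    using ex pivot_elem \<sigma>(1) unfolding m_def pivot_def by blast+
  show False
  proof (cases "m \<in> \<sigma>")
    case True
    then have "(\<sigma>, \<sigma> - {m}) \<in> pivot_matching G"
      using ex \<sigma>(1) by (auto simp: pivot_matching_def m_def)
    then show False using \<sigma>(2) by fastforce
  next
    case False
    then have "(insert m \<sigma>, \<sigma>) \<in> pivot_matching G"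
      unfolding pivot_matching_def using ex \<sigma>(1) m by (auto simp: m_def)
    then show False using \<sigma>(2) by fastforce
  qed
qed

text \<open>
  A mate of the empty set would be \<open>{m}\<close> with \<open>m = 1\<close>.
\<close>

lemma empty_critical:
  assumes "0 \<notin> G"
  shows "{} \<in> critical G (pivot_matching G)"
proof -
  have "{} \<noteq> \<sigma> \<and> {} \<noteq> \<tau>" if e: "(\<sigma>, \<tau>) \<in> pivot_matching G" for \<sigma> \<tau>
  proof -
    obtain m where m: "m \<in> \<sigma>" "\<sigma> \<subseteq> G" "\<tau> = \<sigma> - {m}" using e by (auto simp: pivot_matching_def)
    have "\<tau> \<noteq> {}"
    proof
      assume "\<tau> = {}"
      then have "\<sigma> = {m}" using m by auto
      then have "m = 0"
        using pivot_matching_lcm[OF e] \<open>\<tau> = {}\<close> by (simp add: mono_lcm_empty mono_lcm_singleton)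
      then show False using m assms by auto
    qed
    then show ?thesis using m by auto
  qed
  then show ?thesis by (auto simp: critical_def)
qed


section \<open>The matching as output of the Barile-Macchia algorithm\<close>

text \<open>
  A set of maximal cardinality must contain \<open>m\<close>, since otherwise adding \<open>m\<close> would give a larger
  member of \<open>\<Omega>\<close>. Removing both \<open>\<sigma>\<close> and \<open>\<sigma> - {m}\<close> keeps the collection closed under adding \<open>m\<close>. The set
  \<open>\<sigma> - {m}\<close> need not belong to \<open>\<Omega>\<close>: it has only two elements if \<open>\<sigma>\<close> has three.
\<close>

lemma bm_loop_toggle:
  assumes "finite \<Omega>" "\<And>\<sigma>. \<sigma> \<in> \<Omega> \<Longrightarrow> finite \<sigma>"
    and "\<And>\<sigma>. \<sigma> \<in> \<Omega> \<Longrightarrow> insert m \<sigma> \<in> \<Omega>"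
    and "\<And>\<sigma>. \<sigma> \<in> \<Omega> \<Longrightarrow> m \<in> \<sigma> \<Longrightarrow> sb r \<sigma> = {m}"
  shows "bm_loop r \<Omega> A (A \<union> {(\<sigma>, \<sigma> - {m}) | \<sigma>. \<sigma> \<in> \<Omega> \<and> m \<in> \<sigma>})"
  using assms
proof (induction \<Omega> arbitrary: A rule: finite_psubset_induct)
  case (psubset \<Omega>)
  show ?case
  proof (cases "\<Omega> = {}")
    case True
    then show ?thesis by (simp add: loop_done)
  next
    case False
    have "Max (card ` \<Omega>) \<in> card ` \<Omega>" using psubset.hyps False by (intro Max_in) auto
    then obtain \<sigma> where \<sigma>: "\<sigma> \<in> \<Omega>" "card \<sigma> = Max (card ` \<Omega>)" by auto
    have max: "\<forall>\<tau>\<in>\<Omega>. card \<tau> \<le> card \<sigma>" using psubset.hyps by (simp add: \<sigma>(2))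
    have "m \<in> \<sigma>"
    proof (rule ccontr)
      assume "m \<notin> \<sigma>"
      then have "card \<sigma> < card (insert m \<sigma>)" using psubset.prems(1)[OF \<sigma>(1)] by simp
      then show False using max psubset.prems(2)[OF \<sigma>(1)] by auto
    qed
    then have sb: "sb r \<sigma> = {m}" using psubset.prems(3) \<sigma>(1) by blast
    let ?\<Omega> = "\<Omega> - {\<sigma>, \<sigma> - {m}}"
    have "bm_loop r ?\<Omega> (insert (\<sigma>, \<sigma> - {m}) A)
        (insert (\<sigma>, \<sigma> - {m}) A \<union> {(\<rho>, \<rho> - {m}) | \<rho>. \<rho> \<in> ?\<Omega> \<and> m \<in> \<rho>})"
    proof (rule psubset.IH)
      show "?\<Omega> \<subset> \<Omega>" using \<sigma>(1) by blast
      show "insert m \<rho> \<in> ?\<Omega>" if "\<rho> \<in> ?\<Omega>" for \<rho>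
      proof -
        have "insert m \<rho> \<noteq> \<sigma>"
        proof
          assume "insert m \<rho> = \<sigma>"
          then have "\<rho> = \<sigma> \<or> \<rho> = \<sigma> - {m}" by auto
          then show False using that by blast
        qed
        then show ?thesis using that psubset.prems(2) by auto
      qed
    qed (use psubset.prems in auto)
    also have "insert (\<sigma>, \<sigma> - {m}) A \<union> {(\<rho>, \<rho> - {m}) | \<rho>. \<rho> \<in> ?\<Omega> \<and> m \<in> \<rho>}
        = A \<union> {(\<rho>, \<rho> - {m}) | \<rho>. \<rho> \<in> \<Omega> \<and> m \<in> \<rho>}"
      using \<sigma>(1) \<open>m \<in> \<sigma>\<close> by auto
    finally show ?thesis using loop_step[OF \<sigma>(1) max, of r] by (simp add: sb)
  qed
qed

lemma bm_loop_bridgeless: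
  assumes "finite \<Omega>" "\<And>\<sigma>. \<sigma> \<in> \<Omega> \<Longrightarrow> sb r \<sigma> = {}"
  shows "bm_loop r \<Omega> A A"
  using assms
proof (induction \<Omega> rule: finite_psubset_induct)
  case (psubset \<Omega>)
  show ?case
  proof (cases "\<Omega> = {}")
    case False
    have "Max (card ` \<Omega>) \<in> card ` \<Omega>" using psubset.hyps False by (intro Max_in) auto
    then obtain \<sigma> where \<sigma>: "\<sigma> \<in> \<Omega>" "card \<sigma> = Max (card ` \<Omega>)" by auto
    have max: "\<forall>\<tau>\<in>\<Omega>. card \<tau> \<le> card \<sigma>" using psubset.hyps by (simp add: \<sigma>(2))
    have "bm_loop r (\<Omega> - {\<sigma>, \<sigma> - sb r \<sigma>}) A A"
      by (rule psubset.IH) (use \<sigma> psubset.prems in auto)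
    then show ?thesis using loop_step[OF \<sigma>(1) max, of r A A] psubset.prems \<sigma>(1) by simp
  qed (simp add: loop_done)
qed


text \<open>
  The order that compares values of \<open>h\<close>, except that \<open>m\<close> is moved to the bottom.
\<close>

definition order_with_least :: "('m \<Rightarrow> nat) \<Rightarrow> 'm set \<Rightarrow> 'm \<Rightarrow> 'm rel" where
  "order_with_least h G m = {(a, b). a \<in> G \<and> b \<in> G \<and> (a = m \<or> b \<noteq> m \<and> h a \<le> h b)}"

lemma linear_order_order_with_least:
  assumes "inj_on h G"
  shows "linear_order_on G (order_with_least h G m)"
proof -
  have "antisym (order_with_least h G m)"
    by (rule antisymI) (use inj_onD[OF assms] in \<open>auto simp: order_with_least_def split: if_splits\<close>)
  moreover have "trans (order_with_least h G m)"
    by (rule transI) (auto simp: order_with_least_def)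
  ultimately show ?thesis
    unfolding linear_order_on_def partial_order_on_def preorder_on_def
    by (auto simp: order_with_least_def refl_on_def total_on_def)
qed

lemma sb_cases:
  assumes "linear_order_on G r"
  obtains "sb r \<sigma> = {}" | m where "m \<in> bridges \<sigma>" "sb r \<sigma> = {m}"
proof (cases "sb r \<sigma> = {}")
  case False
  then obtain m where m: "m \<in> sb r \<sigma>" by blast
  have "antisym r" using assms by (simp add: linear_order_on_def partial_order_on_def)
  then have "sb r \<sigma> = {m}" using m by (auto simp: sb_def dest: antisymD)
  then show ?thesis using that(2) m by (auto simp: sb_def)
qed (use that in blast)

lemma sb_order_with_least:
  assumes "\<sigma> \<subseteq> G" "m \<in> bridges \<sigma>"
  shows "sb (order_with_least h G m) \<sigma> = {m}"
proof -
  have "m \<in> G" "\<And>x. x \<in> bridges \<sigma> \<Longrightarrow> x \<in> G" using assms by (auto simp: bridges_def)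
  then show ?thesis using assms(2) by (auto simp: sb_def order_with_least_def)
qed

text \<open>
  Without a pivot there is at most one set with lcm \<open>q\<close>, and it has no bridge. With a pivot \<open>m\<close>, each
  set with lcm \<open>q\<close> that contains \<open>m\<close> has at least three elements: dropping \<open>m\<close> from a smaller one
  would leave the empty set or a single generator, which \<open>m\<close> would have to divide. Distinct edges have
  distinct targets, so nothing is pruned.
\<close>

lemma bm_output_fibre:
  assumes G: "finite G" and zero: "0 \<notin> G"
    and anti: "\<forall>a\<in>G. \<forall>b\<in>G. mono_dvd a b \<longrightarrow> a = b"
    and unique: "\<forall>\<sigma>\<in>Pow G. \<forall>\<tau>\<in>Pow G. mono_lcm \<sigma> = mono_lcm \<tau> \<longrightarrow> \<sigma> \<noteq> \<tau> \<longrightarrow> (\<exists>m. pivot G (mono_lcm \<sigma>) m)"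
    and r: "r = order_with_least h G (pivot_elem G q)"
  shows "bm_output r {\<sigma> \<in> Pow G. mono_lcm \<sigma> = q \<and> card \<sigma> \<ge> 3}
           {(\<sigma>, \<tau>) \<in> pivot_matching G. mono_lcm \<sigma> = q}"
proof -
  let ?\<Omega> = "{\<sigma> \<in> Pow G. mono_lcm \<sigma> = q \<and> card \<sigma> \<ge> 3}"
  let ?A = "{(\<sigma>, \<tau>) \<in> pivot_matching G. mono_lcm \<sigma> = q}"
  have fin: "finite ?\<Omega>" "\<And>\<sigma>. \<sigma> \<subseteq> G \<Longrightarrow> finite \<sigma>" using G finite_subset by auto
  have "bm_loop r ?\<Omega> {} ?A"
  proof (cases "\<exists>m. pivot G q m")
    case True
    define m where "m = pivot_elem G q"
    have m: "m \<in> G" "\<And>\<sigma>. \<sigma> \<subseteq> G \<Longrightarrow> mono_lcm \<sigma> = q \<Longrightarrow> mono_lcm (insert m \<sigma>) = q \<and> mono_lcm (\<sigma> - {m}) = q"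
      using True pivot_elem unfolding m_def pivot_def by blast+
    have sb: "sb r \<sigma> = {m}" if "\<sigma> \<subseteq> G" "mono_lcm \<sigma> = q" "m \<in> \<sigma>" for \<sigma>
      unfolding r m_def[symmetric] using that m(2)[of \<sigma>]
      by (intro sb_order_with_least) (auto simp: bridges_def)
    have card3: "card \<sigma> \<ge> 3" if \<sigma>: "\<sigma> \<subseteq> G" "mono_lcm \<sigma> = q" "m \<in> \<sigma>" for \<sigma>
    proof (rule ccontr)
      assume "\<not> card \<sigma> \<ge> 3"
      moreover have "card (\<sigma> - {m}) = card \<sigma> - 1" using \<sigma>(3) by simp
      ultimately have "card (\<sigma> - {m}) = 0 \<or> card (\<sigma> - {m}) = 1" by linarith
      then have "\<sigma> - {m} = {} \<or> (\<exists>x. \<sigma> - {m} = {x})"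
        using fin(2)[OF \<sigma>(1)] by (auto simp: card_1_singleton_iff)
      moreover have lcm: "mono_lcm (\<sigma> - {m}) = mono_lcm \<sigma>" using m(2)[OF \<sigma>(1,2)] \<sigma>(2) by simp
      moreover have m_dvd: "mono_dvd m (mono_lcm \<sigma>)" using dvd_mono_lcm[OF fin(2)[OF \<sigma>(1)] \<sigma>(3)] .
      ultimately consider "mono_dvd m 0" | x where "\<sigma> - {m} = {x}" "mono_dvd m x"
        by (metis mono_lcm_empty mono_lcm_singleton)
      then show False
      proof cases
        case 1
        then have "m = 0" by (intro mono_dvd_antisym) (auto simp: mono_dvd_def)
        then show False using m(1) zero by simp
      next
        case 2
        then have "m = x" using anti m(1) \<sigma>(1) by blast
        then show False using 2(1) by blast
      qed
    qed
    have "bm_loop r ?\<Omega> {} ({} \<union> {(\<sigma>, \<sigma> - {m}) | \<sigma>. \<sigma> \<in> ?\<Omega> \<and> m \<in> \<sigma>})"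
    proof (rule bm_loop_toggle)
      show "insert m \<sigma> \<in> ?\<Omega>" if "\<sigma> \<in> ?\<Omega>" for \<sigma>
        using that m card3[of "insert m \<sigma>"] by auto
    qed (use fin sb in auto)
    also have "{} \<union> {(\<sigma>, \<sigma> - {m}) | \<sigma>. \<sigma> \<in> ?\<Omega> \<and> m \<in> \<sigma>} = ?A"
      using True card3 by (auto simp: pivot_matching_def m_def)
    finally show ?thesis .
  next
    case False
    have "?A = {}" using False by (auto simp: pivot_matching_def)
    moreover have "bm_loop r ?\<Omega> {} ({} :: (_ set \<times> _ set) set)"
    proof (rule bm_loop_bridgeless[OF fin(1)])
      fix \<sigma> assume \<sigma>: "\<sigma> \<in> ?\<Omega>"
      have "bridges \<sigma> = {}"
      proof (rule ccontr)
        assume "bridges \<sigma> \<noteq> {}"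
        then obtain b where b: "b \<in> \<sigma>" "mono_lcm (\<sigma> - {b}) = mono_lcm \<sigma>" by (auto simp: bridges_def)
        then have "\<sigma> - {b} \<in> Pow G" "\<sigma> \<in> Pow G" "\<sigma> \<noteq> \<sigma> - {b}" using \<sigma> by auto
        then have "\<exists>m. pivot G (mono_lcm \<sigma>) m" using unique b(2) by metis
        then show False using \<sigma> False by simp
      qed
      then show "sb r \<sigma> = {}" by (simp add: sb_def)
    qed
    ultimately show ?thesis by metis
  qed
  moreover have "bm_prune r ?A ?A"
    by (rule prune_done) (auto simp: pivot_matching_def)
  ultimately show ?thesis unfolding bm_output_def by blast
qed

lemma pivot_matching_generalized_bm:
  assumes G: "finite G" and zero: "0 \<notin> G"
    and anti: "\<forall>a\<in>G. \<forall>b\<in>G. mono_dvd a b \<longrightarrow> a = b"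
    and unique: "\<forall>\<sigma>\<in>Pow G. \<forall>\<tau>\<in>Pow G. mono_lcm \<sigma> = mono_lcm \<tau> \<longrightarrow> \<sigma> \<noteq> \<tau> \<longrightarrow> (\<exists>m. pivot G (mono_lcm \<sigma>) m)"
    and e: "inj_on e (mono_lcm ` Pow G)"
  shows "\<exists>le ord. generalized_bm_matching G (e ` mono_lcm ` Pow G) le (e \<circ> mono_lcm) ord (pivot_matching G)"
proof -
  define L where "L = mono_lcm ` Pow G"
  define d where "d = inv_into L e"
  have d: "d (e a) = a" if "a \<in> L" for a using inv_into_f_f e that by (simp add: d_def L_def)
  have inL: "mono_lcm \<sigma> \<in> L" if "\<sigma> \<subseteq> G" for \<sigma> using that by (auto simp: L_def)
  define le where "le = {(e a, e b) | a b. a \<in> L \<and> b \<in> L \<and> mono_dvd a b}"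
  obtain h :: "_ \<Rightarrow> nat" where h: "inj_on h G" using finite_imp_inj_to_nat_seg[OF G] by blast
  define ord where "ord = (\<lambda>p. order_with_least h G (pivot_elem G (d p)))"
  have lin: "linear_order_on G (ord p)" for p
    unfolding ord_def by (rule linear_order_order_with_least[OF h])
  have le_iff: "(e a, e b) \<in> le \<longleftrightarrow> mono_dvd a b" if "a \<in> L" "b \<in> L" for a b
    using that e unfolding L_def[symmetric] by (auto simp: le_def inj_on_eq_iff)
  have po: "partial_order_on (e ` L) le"
  proof -
    have "antisym le"
    proof (rule antisymI)
      fix p q assume pq: "(p, q) \<in> le" "(q, p) \<in> le"
      then obtain a b where "a \<in> L" "b \<in> L" "p = e a" "q = e b" by (auto simp: le_def)
      then show "p = q" using pq le_iff mono_dvd_antisym by metis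
    qed
    moreover have "trans le"
    proof (rule transI)
      fix p q s assume pq: "(p, q) \<in> le" "(q, s) \<in> le"
      then obtain a b c where "a \<in> L" "b \<in> L" "c \<in> L" "p = e a" "q = e b" "s = e c"
        by (auto simp: le_def)
      then show "(p, s) \<in> le" using pq le_iff mono_dvd_trans by metis
    qed
    moreover have "le \<subseteq> e ` L \<times> e ` L" by (auto simp: le_def)
    moreover have "refl_on (e ` L) le"
      by (auto simp: refl_on_def le_iff mono_dvd_refl)
    ultimately show ?thesis by (simp add: partial_order_on_def preorder_on_def)
  qed
  have grading: "lcm_compatible_grading G (e ` L) le (e \<circ> mono_lcm)"
    unfolding lcm_compatible_grading_def
  proof (intro conjI)
    show "e \<circ> mono_lcm \<in> Pow G \<rightarrow> e ` L" using inL by auto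
    show "\<forall>\<sigma>\<in>Pow G. \<forall>\<tau>\<in>Pow G. \<tau> \<subseteq> \<sigma> \<longrightarrow> ((e \<circ> mono_lcm) \<tau>, (e \<circ> mono_lcm) \<sigma>) \<in> le"
      by (simp add: le_iff inL) (blast intro: mono_lcm_mono finite_subset[OF _ G])
    show "\<exists>g :: _ \<Rightarrow> _ \<Rightarrow> int. (\<forall>p\<in>e ` L. \<forall>q\<in>e ` L. (p, q) \<in> le \<longrightarrow> g p \<le> g q) \<and>
        (\<forall>\<sigma>\<in>Pow G. g ((e \<circ> mono_lcm) \<sigma>) = lcm_vec \<sigma>)"
      by (rule exI[of _ "\<lambda>p i. int (lookup (d p) i)"])
        (auto simp: le_iff d inL lcm_vec_def le_fun_def mono_dvd_def)
  qed
  have sb: "\<forall>\<sigma>\<in>Pow G. (e \<circ> mono_lcm) (\<sigma> - sb (ord ((e \<circ> mono_lcm) \<sigma>)) \<sigma>) = (e \<circ> mono_lcm) \<sigma>"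
  proof
    fix \<sigma> assume "\<sigma> \<in> Pow G"
    show "(e \<circ> mono_lcm) (\<sigma> - sb (ord ((e \<circ> mono_lcm) \<sigma>)) \<sigma>) = (e \<circ> mono_lcm) \<sigma>"
      by (rule sb_cases[OF lin, of "(e \<circ> mono_lcm) \<sigma>" \<sigma>]) (auto simp: bridges_def)
  qed
  have out: "\<exists>Ap. (\<forall>p\<in>e ` L. bm_output (ord p) {\<sigma> \<in> Pow G. (e \<circ> mono_lcm) \<sigma> = p \<and> card \<sigma> \<ge> 3} (Ap p)) \<and>
      pivot_matching G = (\<Union>p\<in>e ` L. Ap p)"
  proof (intro exI conjI ballI)
    let ?Ap = "\<lambda>p. {(\<sigma>, \<tau>) \<in> pivot_matching G. mono_lcm \<sigma> = d p}"
    show "pivot_matching G = (\<Union>p\<in>e ` L. ?Ap p)"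
      using inL d by (fastforce simp: pivot_matching_def)
    fix p assume "p \<in> e ` L"
    then obtain q where q: "q \<in> L" "p = e q" by blast
    have "(e \<circ> mono_lcm) \<sigma> = p \<longleftrightarrow> mono_lcm \<sigma> = q" if "\<sigma> \<subseteq> G" for \<sigma>
      using inL[OF that] q d by (metis comp_apply)
    then have "{\<sigma> \<in> Pow G. (e \<circ> mono_lcm) \<sigma> = p \<and> card \<sigma> \<ge> 3} = {\<sigma> \<in> Pow G. mono_lcm \<sigma> = q \<and> card \<sigma> \<ge> 3}"
      by auto
    moreover have "ord p = order_with_least h G (pivot_elem G q)" "d p = q" using q d by (auto simp: ord_def)
    ultimately show "bm_output (ord p) {\<sigma> \<in> Pow G. (e \<circ> mono_lcm) \<sigma> = p \<and> card \<sigma> \<ge> 3} (?Ap p)"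
      using bm_output_fibre[OF G zero anti unique] by simp
  qed
  have "generalized_bm_matching G (e ` L) le (e \<circ> mono_lcm) ord (pivot_matching G)"
    unfolding generalized_bm_matching_def by (intro conjI ballI po grading lin sb out)
  then show ?thesis unfolding L_def by blast
qed


section \<open>Minimal resolutions of generic monomial ideals\<close>

theorem theorem3p1:
  fixes I :: "('n::finite, 'k::field) polys set"
  assumes "monomial_ideal I" and "I \<noteq> UNIV" and "generic_ideal I"
  shows "has_minimal_generalized_bm_resolution I"
proof -
  let ?G = "min_gens I"
  have G: "finite ?G" by (rule finite_min_gens)
  have zero: "0 \<notin> ?G" by (rule zero_notin_min_gens[OF assms(1,2)])
  have unique: "\<forall>\<sigma>\<in>Pow ?G. \<forall>\<tau>\<in>Pow ?G. mono_lcm \<sigma> = mono_lcm \<tau> \<longrightarrow> \<sigma> \<noteq> \<tau> \<longrightarrow>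
      (\<exists>m. pivot ?G (mono_lcm \<sigma>) m)"
    using generic_pivot[OF assms(3) zero] by (metis PowD)
  obtain e :: "'n mono \<Rightarrow> nat" where e: "inj_on e (mono_lcm ` Pow ?G)"
    using finite_imp_inj_to_nat_seg[of "mono_lcm ` Pow ?G"] G by blast
  obtain le ord where bm: "generalized_bm_matching ?G (e ` mono_lcm ` Pow ?G) le (e \<circ> mono_lcm) ord (pivot_matching ?G)"
    using pivot_matching_generalized_bm[OF G zero min_gens_antichain unique e] by blast
  have hom: "homogeneous_acyclic_matching ?G mono_lcm (pivot_matching ?G)"
    by (rule pivot_matching_homogeneous_acyclic[OF G])
  have "inj_on mono_lcm (critical ?G (pivot_matching ?G))"
  proof (rule inj_onI, rule ccontr)
    fix \<sigma> \<tau> assume "\<sigma> \<in> critical ?G (pivot_matching ?G)" "\<tau> \<in> critical ?G (pivot_matching ?G)"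
      "mono_lcm \<sigma> = mono_lcm \<tau>" "\<sigma> \<noteq> \<tau>"
    then show False
      using unique critical_not_pivotal[of \<sigma> ?G] by (auto simp: critical_def)
  qed
  then have "minimal_morse_resolution r I (pivot_matching ?G)" if "linear_order_on ?G r" for r
    using taylor_morse_resolution[OF that G hom empty_critical[OF zero] monomial_ideal_iff_min_gens[OF assms(1)]]
      taylor_morse_minimal[OF G hom]
    by (simp add: minimal_morse_resolution_def Let_def)
  moreover have "homogeneous_acyclic_matching ?G (e \<circ> mono_lcm) (pivot_matching ?G)"
    by (rule pivot_matching_homogeneous_acyclic[OF G]) simp
  ultimately show ?thesis
    unfolding has_minimal_generalized_bm_resolution_def using bm by blast
qed

end
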